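(* Let $N\ge 2$. The factorized blocks of higher root type coincide with the normal ordered blocks, as linear operators on formal power series in $x_1,\dots,x_N$: $$\mathcal{A}_R^{(\mathrm h)}=\mathcal{A}_R^{(\mathrm n)},\qquad \mathcal{A}_L^{(\mathrm h)}=\mathcal{A}_L^{(\mathrm n)}.$$ Here $$\mathcal{A}_L^{(\mathrm h)}=e_q(-\check x_0)\,e_q(-\check x_0\check x_1)\cdots e_q(-\check x_0\check x_1\cdots\check x_{N-2})\cdot e_q(-\check x_{N-1})\cdots e_q(-\check x_1)\cdot\varphi(\Lambda),$$ $$\mathcal{A}_R^{(\mathrm h)}=\varphi(q^{1-N}D_N\Lambda)\cdot e_q(-\hat x_1)\cdots e_q(-\hat x_{N-1})\cdot e_q(-\hat x_{N-2}\cdots\hat x_1\hat x_0)\cdots e_q(-\hat x_1\hat x_0)\,e_q(-\hat x_0),$$ and $\mathcal{A}_L^{(\mathrm n)},\mathcal{A}_R^{(\mathrm n)}$ are defined by $$(\mathcal{A}_L^{(\mathrm n)})^{-1}=\ :\prod_{i=1}^N\frac{1}{\varphi(\check x_i)}:\,,\qquad \mathcal{A}_R^{(\mathrm n)}=\ :\prod_{i=1}^N\varphi(\hat x_i):\,.$$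
   Context: Let $0<|q|<1$. Indices $i$ are in $\mathbb{Z}/N\mathbb{Z}$ (so $x_0=x_N$, etc.), $x_1,\dots,x_N$ are commuting variables, $\vartheta_i=x_i\frac{\partial}{\partial x_i}$, so $q^{\vartheta_i}$ is the operator $x_i\mapsto qx_i$. Let $d_i,\overline d_i$ be nonzero complex parameters, $D_N=\prod_{k=1}^N d_k\overline d_k$, $\Lambda=x_1x_2\cdots x_N$, and define operators on formal power series in $x_1,\dots,x_N$: $$\hat x_i=d_i\overline d_i\,x_i\,q^{\vartheta_i-\vartheta_{i-1}},\qquad \check x_i=x_i\,q^{-\vartheta_i+\vartheta_{i-1}}.$$ Further $\varphi(z)=(z;q)_\infty=\prod_{n\ge0}(1-zq^n)=\sum_{n\ge 0}\frac{q^{n(n-1)/2}(-z)^n}{(q;q)_n}$ and $e_q(z)=\varphi(z)^{-1}=\sum_{n\ge0}\frac{z^n}{(q;q)_n}$, with $(q;q)_n=\prod_{k=1}^n(1-q^k)$; with operator arguments these are understood through their power series. Normal ordering: for a function $F(x,\theta)$ of $2N$ commuting variables $x=(x_i)$, $\theta=(\theta_i)$ (a power series in $x$ with coefficients depending on $\theta$), the operator $:F(x,\vartheta):$ is the linear operator with $:F(x,\vartheta):\,x^\nu=F(x,\nu)\,x^\nu$ on monomials $x^\nu=\prod_i x_i^{\nu_i}$, extended linearly to formal power series. Inside $:\ :$ the symbols $x_i$ and $\vartheta_j$ are treated as commuting; e.g. $:\prod_i\varphi(\hat x_i):\,x^\nu=\prod_i\varphi(d_i\overline d_i x_iq^{\nu_i-\nu_{i-1}})\,x^\nu$.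 *)

theory Defs
  imports "HOL-Computational_Algebra.Formal_Power_Series"
begin

unbundle fps_syntax

section \<open>The series \<open>\<phi>\<close> and \<open>e\<^sub>q\<close>\<close>

definition q_fact :: "complex \<Rightarrow> nat \<Rightarrow> complex" where
  "q_fact q n = (\<Prod>k=1..n. 1 - q ^ k)"

definition phi :: "complex \<Rightarrow> complex fps" where
  "phi q = Abs_fps (\<lambda>n. q ^ (n * (n - 1) div 2) * (- 1) ^ n / q_fact q n)"

definition e_q :: "complex \<Rightarrow> complex fps" where
  "e_q q = Abs_fps (\<lambda>n. 1 / q_fact q n)"

text \<open>
  The rest of this section checks that, for \<open>0 < |q| < 1\<close>, the series \<^const>\<open>e_q\<close> is the
  reciprocal of \<^const>\<open>phi\<close>, and that \<^const>\<open>phi\<close> sums to the infinite product \<open>(z; q)\<^sub>\<infinity>\<close>.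
\<close>

lemma one_minus_power_neq_0:
  fixes q :: complex
  assumes "norm q < 1" "0 < n"
  shows "1 - q ^ n \<noteq> 0"
proof
  assume "1 - q ^ n = 0"
  hence "norm q ^ n = 1" by (metis eq_iff_diff_eq_0 norm_one norm_power)
  moreover have "norm q ^ n < 1" using assms by (simp add: power_less_one_iff)
  ultimately show False by simp
qed

lemma q_fact_0 [simp]: "q_fact q 0 = 1"
  by (simp add: q_fact_def)

lemma q_fact_Suc: "q_fact q (Suc n) = q_fact q n * (1 - q ^ Suc n)"
  by (simp add: q_fact_def)

lemma q_fact_neq_0: "norm q < 1 \<Longrightarrow> q_fact q n \<noteq> 0"
  using one_minus_power_neq_0[of q] by (auto simp: q_fact_def)

lemma phi_nth_0 [simp]: "phi q $ 0 = 1"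
  by (simp add: phi_def)

lemma e_q_nth_0 [simp]: "e_q q $ 0 = 1"
  by (simp add: e_q_def)

lemma phi_nth_Suc:
  assumes "norm q < 1"
  shows "(1 - q ^ Suc n) * phi q $ Suc n = - (q ^ n * phi q $ n)"
proof -
  have "Suc n * n div 2 = n * (n - 1) div 2 + n"
    by (cases n) (auto simp: algebra_simps)
  thus ?thesis
    using q_fact_neq_0[OF assms, of n] one_minus_power_neq_0[OF assms, of "Suc n"]
    by (simp add: phi_def q_fact_Suc power_add divide_simps del: power_Suc) (simp add: algebra_simps)
qed

lemma e_q_nth_Suc:
  assumes "norm q < 1"
  shows "(1 - q ^ Suc n) * e_q q $ Suc n = e_q q $ n"
  using q_fact_neq_0[OF assms, of n] one_minus_power_neq_0[OF assms, of "Suc n"]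
  by (simp add: e_q_def q_fact_Suc divide_simps del: power_Suc)

lemma e_q_eq_inverse_phi:
  assumes "norm q < 1"
  shows "e_q q = inverse (phi q)"
proof -
  define s :: "complex fps \<Rightarrow> complex fps" where "s f = f oo (fps_const q * fps_X)" for f
  have s_nth: "s f $ n = q ^ n * f $ n" for f n
    by (simp add: s_def fps_compose_linear)
  have s_mult: "s (f * g) = s f * s g" for f g
    unfolding s_def by (rule fps_compose_mult_distrib) simp
  have phi_eq: "phi q = (1 - fps_X) * s (phi q)"
  proof (rule fps_ext)
    fix n show "phi q $ n = ((1 - fps_X) * s (phi q)) $ n"
    proof (cases n)
      case (Suc m)
      thus ?thesis using phi_nth_Suc[OF assms, of m]
        by (simp add: s_nth ring_distribs del: power_Suc) (simp add: algebra_simps)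
    qed (simp add: s_nth)
  qed
  have e_eq: "s (e_q q) = (1 - fps_X) * e_q q"
  proof (rule fps_ext)
    fix n show "s (e_q q) $ n = ((1 - fps_X) * e_q q) $ n"
    proof (cases n)
      case (Suc m)
      thus ?thesis using e_q_nth_Suc[OF assms, of m]
        by (simp add: s_nth ring_distribs del: power_Suc) (simp add: algebra_simps)
    qed (simp add: s_nth)
  qed
  have s_prod: "s (phi q * e_q q) = phi q * e_q q"
    by (subst (2) phi_eq) (simp add: s_mult e_eq mult_ac)
  have "phi q * e_q q = 1"
  proof (rule fps_ext)
    fix n show "(phi q * e_q q) $ n = 1 $ n"
    proof (cases "n = 0")
      case False
      have "(1 - q ^ n) * (phi q * e_q q) $ n = 0"
        using arg_cong[OF s_prod, of "\<lambda>f. f $ n"] by (simp add: s_nth left_diff_distrib)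
      thus ?thesis using one_minus_power_neq_0[OF assms, of n] False by simp
    qed simp
  qed
  thus ?thesis by (metis fps_inverse_unique)
qed

lemma phi_summable:
  assumes "norm q < 1"
  shows "summable (\<lambda>n. phi q $ n * z ^ n)"
proof -
  have "(\<lambda>n. q ^ n * z / (1 - q ^ Suc n)) \<longlonglongrightarrow> 0 * z / (1 - 0)"
    by (intro tendsto_intros LIMSEQ_power_zero LIMSEQ_Suc) (use assms in auto)
  hence "(\<lambda>n. norm (q ^ n * z / (1 - q ^ Suc n))) \<longlonglongrightarrow> 0"
    by (intro tendsto_norm_zero) simp
  hence "eventually (\<lambda>n. norm (q ^ n * z / (1 - q ^ Suc n)) < 1 / 2) sequentially"
    by (rule order_tendstoD) simp
  then obtain M where M: "\<And>n. n \<ge> M \<Longrightarrow> norm (q ^ n * z / (1 - q ^ Suc n)) < 1 / 2"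
    unfolding eventually_sequentially by blast
  show ?thesis
  proof (rule summable_ratio_test[of "1 / 2" M])
    fix n assume "n \<ge> M"
    have "phi q $ Suc n = - (q ^ n / (1 - q ^ Suc n)) * phi q $ n"
      using phi_nth_Suc[OF assms, of n] one_minus_power_neq_0[OF assms, of "Suc n"]
      by (simp add: field_simps del: power_Suc)
    hence "norm (phi q $ Suc n * z ^ Suc n) =
        norm (q ^ n * z / (1 - q ^ Suc n)) * norm (phi q $ n * z ^ n)"
      by (simp add: norm_mult norm_divide norm_power mult_ac)
    also have "\<dots> \<le> 1 / 2 * norm (phi q $ n * z ^ n)"
      by (rule mult_right_mono[OF less_imp_le[OF M[OF \<open>n \<ge> M\<close>]] norm_ge_zero])
    finally show "norm (phi q $ Suc n * z ^ Suc n) \<le> 1 / 2 * norm (phi q $ n * z ^ n)" .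
  qed simp
qed

lemma phi_infinite_product:
  assumes "norm q < 1"
  shows "(\<lambda>M. \<Prod>n<M. 1 - z * q ^ n) \<longlonglongrightarrow> (\<Sum>n. phi q $ n * z ^ n)"
proof -
  define F where "F z = (\<Sum>n. phi q $ n * z ^ n)" for z
  have F_sums: "(\<lambda>n. phi q $ n * z ^ n) sums F z" for z
    unfolding F_def by (rule summable_sums[OF phi_summable[OF assms]])
  have F_eq: "F z = (1 - z) * F (q * z)" for z
  proof -
    have 1: "(\<lambda>n. phi q $ Suc n * z ^ Suc n) sums (F z - 1)"
      using F_sums[of z] by (subst sums_Suc_iff) simp
    have 2: "(\<lambda>n. phi q $ Suc n * (q * z) ^ Suc n) sums (F (q * z) - 1)"
      using F_sums[of "q * z"] by (subst sums_Suc_iff) simp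
    have 3: "(\<lambda>n. z * (phi q $ n * (q * z) ^ n)) sums (z * F (q * z))"
      by (rule sums_mult[OF F_sums])
    have "phi q $ Suc n * z ^ Suc n =
        phi q $ Suc n * (q * z) ^ Suc n - z * (phi q $ n * (q * z) ^ n)" for n
    proof -
      have "phi q $ Suc n * z ^ Suc n - phi q $ Suc n * (q * z) ^ Suc n =
          (1 - q ^ Suc n) * phi q $ Suc n * z ^ Suc n"
        by (simp add: power_mult_distrib algebra_simps del: power_Suc)
      also have "\<dots> = - (z * (phi q $ n * (q * z) ^ n))"
        by (subst phi_nth_Suc[OF assms]) (simp add: power_mult_distrib)
      finally show ?thesis by (simp add: algebra_simps)
    qed
    hence "(\<lambda>n. phi q $ Suc n * z ^ Suc n) sums (F (q * z) - 1 - z * F (q * z))"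
      using sums_diff[OF 2 3] by presburger
    with 1 have "F z - 1 = F (q * z) - 1 - z * F (q * z)" by (rule sums_unique2)
    thus ?thesis by (simp add: algebra_simps)
  qed
  have F_iter: "F z = (\<Prod>n<M. 1 - z * q ^ n) * F (q ^ M * z)" for M
  proof (induction M)
    case (Suc M)
    thus ?case using F_eq[of "q ^ M * z"] by (simp add: mult_ac)
  qed simp
  have "isCont F 0"
    unfolding F_def by (rule isCont_powser[of _ 1]) (use phi_summable[OF assms, of 1] in auto)
  moreover have "(\<lambda>M. q ^ M * z) \<longlonglongrightarrow> 0 * z"
    by (intro tendsto_intros LIMSEQ_power_zero assms)
  ultimately have "(\<lambda>M. F (q ^ M * z)) \<longlonglongrightarrow> F 0"
    using isCont_tendsto_compose[of 0 F] by simp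
  moreover have "F 0 = 1" by (simp add: F_def)
  ultimately have lim: "(\<lambda>M. F (q ^ M * z)) \<longlonglongrightarrow> 1" by simp
  hence "(\<lambda>M. F z / F (q ^ M * z)) \<longlonglongrightarrow> F z / 1"
    by (intro tendsto_intros) auto
  moreover have "eventually (\<lambda>M. F (q ^ M * z) \<noteq> 0) sequentially"
    by (rule tendsto_imp_eventually_ne[OF lim]) simp
  hence "eventually (\<lambda>M. F z / F (q ^ M * z) = (\<Prod>n<M. 1 - z * q ^ n)) sequentially"
    by eventually_elim (metis F_iter nonzero_mult_div_cancel_right)
  ultimately have "(\<lambda>M. \<Prod>n<M. 1 - z * q ^ n) \<longlonglongrightarrow> F z"
    by (simp add: tendsto_cong)
  thus ?thesis by (simp add: F_def)
qed


section \<open>Formal power series in \<open>N\<close> variables\<close>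

text \<open>
  The residues modulo \<open>N\<close> are represented by \<open>0, \<dots>, N - 1\<close>, so that \<open>x\<^sub>0\<close> is the variable
  \<open>x\<^sub>N\<close>. An exponent is a function \<open>\<nu> :: nat \<Rightarrow> nat\<close> vanishing outside \<open>{..<N}\<close>, and a power series
  is its coefficient function, vanishing outside these exponents. On exponents, \<open>\<le>\<close> and \<open>-\<close>
  are the pointwise operations of the function space.
\<close>

type_synonym exponent = "nat \<Rightarrow> nat"
type_synonym mps = "exponent \<Rightarrow> complex"

definition exponents :: "nat \<Rightarrow> exponent set" where
  "exponents N = {\<nu>. \<forall>i\<ge>N. \<nu> i = 0}"

definition mps_space :: "nat \<Rightarrow> mps set" where
  "mps_space N = {f. \<forall>\<nu>. \<nu> \<notin> exponents N \<longrightarrow> f \<nu> = 0}"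

definition mps_one :: mps where
  "mps_one = (\<lambda>\<nu>. if \<nu> = (\<lambda>_. 0) then 1 else 0)"

definition mps_var :: "nat \<Rightarrow> mps" where
  "mps_var i = (\<lambda>\<nu>. if \<nu> = (\<lambda>_. 0)(i := 1) then 1 else 0)"

definition mps_scale :: "complex \<Rightarrow> mps \<Rightarrow> mps" where
  "mps_scale c f = (\<lambda>\<nu>. c * f \<nu>)"

definition mps_mult :: "mps \<Rightarrow> mps \<Rightarrow> mps" where
  "mps_mult f g = (\<lambda>\<mu>. \<Sum>\<nu>\<in>{..\<mu>}. f \<nu> * g (\<mu> - \<nu>))"

definition mps_prod :: "mps list \<Rightarrow> mps" where
  "mps_prod fs = foldr mps_mult fs mps_one"


section \<open>Operators\<close>

text \<open>Products of operators are compositions: the rightmost factor acts first.\<close>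

definition op_prod :: "(mps \<Rightarrow> mps) list \<Rightarrow> mps \<Rightarrow> mps" where
  "op_prod Ts = foldr (\<circ>) Ts id"

text \<open>
  The operator \<open>\<Sum>\<^sub>n F\<^sub>n T\<^sup>n\<close>, summed coefficient by coefficient. For operators \<open>T\<close>
  that raise the total degree, as all operators below do, each of these sums has only finitely
  many nonzero terms.
\<close>

definition op_series :: "complex fps \<Rightarrow> (mps \<Rightarrow> mps) \<Rightarrow> mps \<Rightarrow> mps" where
  "op_series F T f = (\<lambda>\<nu>. \<Sum>n. F $ n * (T ^^ n) f \<nu>)"

text \<open>The substitution \<open>F(g)\<close>, for \<open>g\<close> without constant term.\<close>

definition mps_subst :: "complex fps \<Rightarrow> mps \<Rightarrow> mps" where
  "mps_subst F g = op_series F (mps_mult g) mps_one"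

text \<open>The operator \<open>q\<^bsup>L(\<vartheta>)\<^esup>\<close>, which acts on \<open>x\<^sup>\<nu>\<close> as multiplication by \<open>q\<^bsup>L(\<nu>)\<^esup>\<close>.\<close>

definition q_theta :: "complex \<Rightarrow> ((nat \<Rightarrow> int) \<Rightarrow> int) \<Rightarrow> mps \<Rightarrow> mps" where
  "q_theta q L f = (\<lambda>\<nu>. q powi L (\<lambda>i. int (\<nu> i)) * f \<nu>)"

text \<open>
  For \<open>F(x, \<theta>)\<close>, given as a power series \<open>F \<theta>\<close> in \<open>x\<close> for each \<open>\<theta>\<close>, this is the operator
  \<open>x\<^sup>\<nu> \<mapsto> F(x, \<nu>) x\<^sup>\<nu>\<close>, extended to power series: the coefficient of \<open>x\<^sup>\<mu>\<close> in the image of \<open>f\<close>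
  collects that of \<open>x\<^bsup>\<mu>-\<nu>\<^esup>\<close> in \<open>F(x, \<nu>)\<close>, for all \<open>\<nu> \<le> \<mu>\<close>.
\<close>

definition normal_ordered :: "((nat \<Rightarrow> int) \<Rightarrow> mps) \<Rightarrow> mps \<Rightarrow> mps" where
  "normal_ordered F f = (\<lambda>\<mu>. \<Sum>\<nu>\<in>{..\<mu>}. f \<nu> * F (\<lambda>i. int (\<nu> i)) (\<mu> - \<nu>))"

definition cyc_pred :: "nat \<Rightarrow> nat \<Rightarrow> nat" where
  "cyc_pred N i = (i + N - 1) mod N"

definition x_hat :: "nat \<Rightarrow> complex \<Rightarrow> (nat \<Rightarrow> complex) \<Rightarrow> (nat \<Rightarrow> complex) \<Rightarrow> nat \<Rightarrow> mps \<Rightarrow> mps" where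
  "x_hat N q d db i =
     mps_scale (d i * db i) \<circ> mps_mult (mps_var i) \<circ> q_theta q (\<lambda>\<theta>. \<theta> i - \<theta> (cyc_pred N i))"

definition x_check :: "nat \<Rightarrow> complex \<Rightarrow> nat \<Rightarrow> mps \<Rightarrow> mps" where
  "x_check N q i = mps_mult (mps_var i) \<circ> q_theta q (\<lambda>\<theta>. - \<theta> i + \<theta> (cyc_pred N i))"

text \<open>The same expressions with commuting symbols \<open>x\<close> and \<open>\<theta>\<close>, as they occur inside \<open>: :\<close>.\<close>

definition x_hat_symbol ::
  "nat \<Rightarrow> complex \<Rightarrow> (nat \<Rightarrow> complex) \<Rightarrow> (nat \<Rightarrow> complex) \<Rightarrow> nat \<Rightarrow> (nat \<Rightarrow> int) \<Rightarrow> mps" where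
  "x_hat_symbol N q d db i \<theta> =
     mps_scale (d i * db i * q powi (\<theta> i - \<theta> (cyc_pred N i))) (mps_var i)"

definition x_check_symbol :: "nat \<Rightarrow> complex \<Rightarrow> nat \<Rightarrow> (nat \<Rightarrow> int) \<Rightarrow> mps" where
  "x_check_symbol N q i \<theta> = mps_scale (q powi (- \<theta> i + \<theta> (cyc_pred N i))) (mps_var i)"

definition Lambda :: "nat \<Rightarrow> mps" where
  "Lambda N = mps_prod (map mps_var [0..<N])"

definition D_const :: "nat \<Rightarrow> (nat \<Rightarrow> complex) \<Rightarrow> (nat \<Rightarrow> complex) \<Rightarrow> complex" where
  "D_const N d db = (\<Prod>k<N. d k * db k)"


section \<open>The blocks\<close>

definition A_L_h :: "nat \<Rightarrow> complex \<Rightarrow> mps \<Rightarrow> mps" where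
  "A_L_h N q = op_prod (
     map (\<lambda>k. op_series (e_q q) (mps_scale (-1) \<circ> op_prod (map (x_check N q) [0..<Suc k]))) [0..<N - 1]
     @ map (\<lambda>i. op_series (e_q q) (mps_scale (-1) \<circ> x_check N q i)) (rev [1..<N])
     @ [op_series (phi q) (mps_mult (Lambda N))])"

definition A_R_h :: "nat \<Rightarrow> complex \<Rightarrow> (nat \<Rightarrow> complex) \<Rightarrow> (nat \<Rightarrow> complex) \<Rightarrow> mps \<Rightarrow> mps" where
  "A_R_h N q d db = op_prod (
     [op_series (phi q) (mps_mult (mps_scale (q powi (1 - int N) * D_const N d db) (Lambda N)))]
     @ map (\<lambda>i. op_series (e_q q) (mps_scale (-1) \<circ> x_hat N q d db i)) [1..<N]
     @ map (\<lambda>k. op_series (e_q q)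
              (mps_scale (-1) \<circ> op_prod (map (x_hat N q d db) (rev [0..<Suc k])))) (rev [0..<N - 1]))"

definition A_R_n :: "nat \<Rightarrow> complex \<Rightarrow> (nat \<Rightarrow> complex) \<Rightarrow> (nat \<Rightarrow> complex) \<Rightarrow> mps \<Rightarrow> mps" where
  "A_R_n N q d db =
     normal_ordered (\<lambda>\<theta>. mps_prod (map (\<lambda>i. mps_subst (phi q) (x_hat_symbol N q d db i \<theta>)) [0..<N]))"

definition A_L_n_inverse :: "nat \<Rightarrow> complex \<Rightarrow> mps \<Rightarrow> mps" where
  "A_L_n_inverse N q =
     normal_ordered (\<lambda>\<theta>. mps_prod (map (\<lambda>i. mps_subst (inverse (phi q)) (x_check_symbol N q i \<theta>)) [0..<N]))"

text \<open>
  The inverse is taken on the space of power series in \<open>N\<close> variables, on which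
  \<^const>\<open>A_L_n_inverse\<close> is bijective; see \<open>bij_betw_A_L_n_inverse\<close> below.
\<close>

definition A_L_n :: "nat \<Rightarrow> complex \<Rightarrow> mps \<Rightarrow> mps" where
  "A_L_n N q = inv_into (mps_space N) (A_L_n_inverse N q)"


section \<open>Invertibility of the normal ordered operators\<close>

lemma mps_space_mult:
  assumes "f \<in> mps_space N" "g \<in> mps_space N"
  shows "mps_mult f g \<in> mps_space N"
  unfolding mps_space_def
proof safe
  fix \<mu> assume "\<mu> \<notin> exponents N"
  then obtain i where i: "i \<ge> N" "\<mu> i \<noteq> 0" by (auto simp: exponents_def)
  have "f \<nu> * g (\<mu> - \<nu>) = 0" if "\<nu> \<le> \<mu>" for \<nu>
  proof (rule ccontr)
    assume "f \<nu> * g (\<mu> - \<nu>) \<noteq> 0"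
    hence "\<nu> \<in> exponents N" "\<mu> - \<nu> \<in> exponents N" using assms by (auto simp: mps_space_def)
    thus False using i by (auto simp: exponents_def)
  qed
  thus "mps_mult f g \<mu> = 0" unfolding mps_mult_def by (intro sum.neutral) simp
qed

lemma mps_space_one: "mps_one \<in> mps_space N"
  by (auto simp: mps_one_def mps_space_def exponents_def)

lemma mps_space_var: "i < N \<Longrightarrow> mps_var i \<in> mps_space N"
  by (auto simp: mps_var_def mps_space_def exponents_def)

lemma mps_space_scale: "f \<in> mps_space N \<Longrightarrow> mps_scale c f \<in> mps_space N"
  by (auto simp: mps_scale_def mps_space_def)

lemma mps_space_prod: "set fs \<subseteq> mps_space N \<Longrightarrow> mps_prod fs \<in> mps_space N"
  by (induction fs) (auto simp: mps_prod_def mps_space_one mps_space_mult)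

lemma mps_space_funpow:
  assumes "\<And>f. f \<in> mps_space N \<Longrightarrow> T f \<in> mps_space N" "f \<in> mps_space N"
  shows "(T ^^ n) f \<in> mps_space N"
  by (induction n) (use assms in auto)

lemma mps_space_subst:
  assumes "g \<in> mps_space N"
  shows "mps_subst F g \<in> mps_space N"
proof -
  have "(mps_mult g ^^ n) mps_one \<in> mps_space N" for n
    by (intro mps_space_funpow mps_space_mult assms mps_space_one)
  thus ?thesis by (simp add: mps_subst_def op_series_def mps_space_def)
qed

lemma atMost_zero_exponent: "{..(\<lambda>_. 0) :: exponent} = {\<lambda>_. 0}"
  by (auto simp: le_fun_def)

lemma mps_mult_zero: "mps_mult f g (\<lambda>_. 0) = f (\<lambda>_. 0) * g (\<lambda>_. 0)"
  by (simp add: mps_mult_def atMost_zero_exponent fun_diff_def)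

lemma mps_prod_zero: "mps_prod fs (\<lambda>_. 0) = prod_list (map (\<lambda>f. f (\<lambda>_. 0)) fs)"
  by (induction fs) (auto simp: mps_prod_def mps_mult_zero, simp add: mps_one_def)

lemma mps_subst_zero:
  assumes "g (\<lambda>_. 0) = 0"
  shows "mps_subst F g (\<lambda>_. 0) = F $ 0"
proof -
  have pow: "(mps_mult g ^^ n) mps_one (\<lambda>_. 0) = (if n = 0 then 1 else 0)" for n
    by (cases n) (auto simp: mps_mult_zero assms mps_one_def)
  have "mps_subst F g (\<lambda>_. 0) = (\<Sum>n. F $ n * (if n = 0 then 1 else 0))"
    by (simp only: mps_subst_def op_series_def pow)
  also have "\<dots> = (\<Sum>n\<in>{0}. F $ n * (if n = 0 then 1 else 0))"
    by (rule suminf_finite) auto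
  finally show ?thesis by simp
qed

lemma finite_atMost_exponent:
  assumes "\<mu> \<in> exponents N"
  shows "finite {..\<mu>}"
proof (rule finite_subset)
  show "{..\<mu>} \<subseteq> {\<nu>. \<forall>i. (i \<in> {..<N} \<longrightarrow> \<nu> i \<in> {..Max (\<mu> ` {..<N})}) \<and> (i \<notin> {..<N} \<longrightarrow> \<nu> i = 0)}"
  proof (intro subsetI CollectI allI conjI impI)
    fix \<nu> i assume "\<nu> \<in> {..\<mu>}" "i \<in> {..<N}"
    hence "\<nu> \<le> \<mu>" "i < N" by auto
    hence "\<nu> i \<le> Max (\<mu> ` {..<N})"
      by (meson Max_ge finite_imageI finite_lessThan imageI le_funD lessThan_iff order_trans)
    thus "\<nu> i \<in> {..Max (\<mu> ` {..<N})}" by simp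
  next
    fix \<nu> i assume "\<nu> \<in> {..\<mu>}" "i \<notin> {..<N}"
    thus "\<nu> i = 0" using assms le_funD[of \<nu> \<mu> i] by (auto simp: exponents_def)
  qed
  show "finite {\<nu>. \<forall>i. (i \<in> {..<N} \<longrightarrow> \<nu> i \<in> {..Max (\<mu> ` {..<N})}) \<and> (i \<notin> {..<N} \<longrightarrow> \<nu> i = (0::nat))}"
    by (intro finite_set_of_finite_funs) auto
qed

lemma exponents_mono: "\<mu> \<in> exponents N \<Longrightarrow> \<nu> \<le> \<mu> \<Longrightarrow> \<nu> \<in> exponents N"
  by (auto simp: exponents_def le_fun_def) (metis le_zero_eq)

lemma degree_strict_mono:
  fixes \<mu> \<nu> :: exponent
  assumes "\<mu> \<in> exponents N" "\<nu> < \<mu>"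
  shows "(\<Sum>i<N. \<nu> i) < (\<Sum>i<N. \<mu> i)"
proof (rule sum_strict_mono_ex1)
  show "\<forall>i\<in>{..<N}. \<nu> i \<le> \<mu> i" using assms by (auto simp: less_fun_def le_fun_def)
  obtain i where "\<nu> i < \<mu> i" using assms by (auto simp: less_fun_def le_fun_def not_le)
  moreover from this have "i < N"
    using assms(1) by (cases "i < N") (auto simp: exponents_def)
  ultimately show "\<exists>i\<in>{..<N}. \<nu> i < \<mu> i" by auto
qed simp

lemma bij_betw_normal_ordered:
  assumes space: "\<And>\<theta>. F \<theta> \<in> mps_space N" and const: "\<And>\<theta>. F \<theta> (\<lambda>_. 0) = 1"
  shows "bij_betw (normal_ordered F) (mps_space N) (mps_space N)"
proof -
  define rest where "rest f \<mu> = (\<Sum>\<nu>\<in>{..<\<mu>}. f \<nu> * F (\<lambda>i. int (\<nu> i)) (\<mu> - \<nu>))" for f and \<mu> :: exponent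
  have split: "normal_ordered F f \<mu> = f \<mu> + rest f \<mu>" if "\<mu> \<in> exponents N" for f \<mu>
  proof -
    have "{..\<mu>} = insert \<mu> {..<\<mu>}" by auto
    moreover have "finite {..<\<mu>}"
      by (rule finite_subset[OF _ finite_atMost_exponent[OF that]]) auto
    ultimately show ?thesis
      by (simp add: normal_ordered_def rest_def fun_diff_def const)
  qed
  have rest_cong: "rest f \<mu> = rest g \<mu>" if "\<And>\<nu>. \<nu> < \<mu> \<Longrightarrow> f \<nu> = g \<nu>" for f g \<mu>
    unfolding rest_def by (rule sum.cong) (auto simp: that)
  have closed: "normal_ordered F f \<in> mps_space N" if f: "f \<in> mps_space N" for f
    unfolding mps_space_def
  proof safe
    fix \<mu> assume "\<mu> \<notin> exponents N"
    then obtain i where i: "i \<ge> N" "\<mu> i \<noteq> 0" by (auto simp: exponents_def)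
    have "f \<nu> * F (\<lambda>i. int (\<nu> i)) (\<mu> - \<nu>) = 0" if "\<nu> \<le> \<mu>" for \<nu>
    proof (rule ccontr)
      assume "f \<nu> * F (\<lambda>i. int (\<nu> i)) (\<mu> - \<nu>) \<noteq> 0"
      hence "\<nu> \<in> exponents N" "\<mu> - \<nu> \<in> exponents N"
        using f space[of "\<lambda>i. int (\<nu> i)"] by (auto simp: mps_space_def)
      thus False using i by (auto simp: exponents_def)
    qed
    thus "normal_ordered F f \<mu> = 0" unfolding normal_ordered_def by (intro sum.neutral) simp
  qed
  have inj: "inj_on (normal_ordered F) (mps_space N)"
  proof (rule inj_onI)
    fix f g assume fg: "f \<in> mps_space N" "g \<in> mps_space N" "normal_ordered F f = normal_ordered F g"
    have "f \<mu> = g \<mu>" if "\<mu> \<in> exponents N" for \<mu>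
      using that
    proof (induction "\<Sum>i<N. \<mu> i" arbitrary: \<mu> rule: less_induct)
      case less
      have "rest f \<mu> = rest g \<mu>"
      proof (rule rest_cong)
        fix \<nu> assume "\<nu> < \<mu>"
        thus "f \<nu> = g \<nu>"
          by (intro less.hyps degree_strict_mono less.prems exponents_mono[OF less.prems]) auto
      qed
      thus ?case using split[OF less.prems, of f] split[OF less.prems, of g] fg(3) by simp
    qed
    moreover have "f \<mu> = g \<mu>" if "\<mu> \<notin> exponents N" for \<mu>
      using fg(1,2) that by (simp add: mps_space_def)
    ultimately show "f = g" by (intro ext) metis
  qed
  have "\<exists>f\<in>mps_space N. normal_ordered F f = h" if h: "h \<in> mps_space N" for h
  proof -
    define T where "T f \<mu> = (if \<mu> \<in> exponents N then h \<mu> - rest f \<mu> else 0)" for f \<mu>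
    define s where "s k = (T ^^ k) h" for k
    have s_Suc: "s (Suc k) = T (s k)" for k by (simp add: s_def)
    have stab: "s (Suc k) \<mu> = s k \<mu>" if "\<mu> \<in> exponents N" "(\<Sum>i<N. \<mu> i) \<le> k" for k \<mu>
      using that
    proof (induction k arbitrary: \<mu>)
      case 0
      have "{..<\<mu>} = {}" using degree_strict_mono[OF 0(1)] 0(2) by auto
      thus ?case by (simp add: s_def T_def rest_def 0)
    next
      case (Suc k)
      have "rest (s (Suc k)) \<mu> = rest (s k) \<mu>"
      proof (rule rest_cong)
        fix \<nu> assume "\<nu> < \<mu>"
        thus "s (Suc k) \<nu> = s k \<nu>"
          using degree_strict_mono[OF Suc.prems(1) \<open>\<nu> < \<mu>\<close>] Suc.prems
          by (intro Suc.IH exponents_mono[OF Suc.prems(1)]) auto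
      qed
      thus ?case by (simp add: s_Suc[of k] s_Suc[of "Suc k"] T_def)
    qed
    have stab': "s (n + (\<Sum>i<N. \<mu> i)) \<mu> = s (\<Sum>i<N. \<mu> i) \<mu>" if "\<mu> \<in> exponents N" for n \<mu>
      by (induction n) (simp_all add: stab that)
    have stab'': "s k \<mu> = s (\<Sum>i<N. \<mu> i) \<mu>" if "\<mu> \<in> exponents N" "(\<Sum>i<N. \<mu> i) \<le> k" for k \<mu>
      using stab'[OF that(1), of "k - (\<Sum>i<N. \<mu> i)"] that(2) by simp
    define f where "f \<mu> = (if \<mu> \<in> exponents N then s (\<Sum>i<N. \<mu> i) \<mu> else 0)" for \<mu>
    have f: "f \<in> mps_space N" by (simp add: f_def mps_space_def)
    have "normal_ordered F f \<mu> = h \<mu>" if mu: "\<mu> \<in> exponents N" for \<mu>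
    proof -
      let ?k = "\<Sum>i<N. \<mu> i"
      have "rest f \<mu> = rest (s ?k) \<mu>"
      proof (rule rest_cong)
        fix \<nu> assume "\<nu> < \<mu>"
        hence nu: "\<nu> \<in> exponents N" by (intro exponents_mono[OF mu]) auto
        have "s ?k \<nu> = s (\<Sum>i<N. \<nu> i) \<nu>"
          using degree_strict_mono[OF mu \<open>\<nu> < \<mu>\<close>] by (intro stab'' nu) simp
        thus "f \<nu> = s ?k \<nu>" using nu by (simp add: f_def)
      qed
      moreover have "f \<mu> = s (Suc ?k) \<mu>" using mu by (simp add: f_def stab)
      ultimately show ?thesis using mu by (simp add: split s_Suc T_def)
    qed
    moreover have "normal_ordered F f \<mu> = h \<mu>" if "\<mu> \<notin> exponents N" for \<mu>
      using closed[OF f] h that by (simp add: mps_space_def)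
    ultimately have "normal_ordered F f = h" by (intro ext) metis
    thus ?thesis using f by blast
  qed
  thus ?thesis using inj closed by (auto simp: bij_betw_def)
qed

lemma bij_betw_A_L_n_inverse: "bij_betw (A_L_n_inverse N q) (mps_space N) (mps_space N)"
  unfolding A_L_n_inverse_def
proof (rule bij_betw_normal_ordered)
  fix \<theta> :: "nat \<Rightarrow> int"
  show "mps_prod (map (\<lambda>i. mps_subst (inverse (phi q)) (x_check_symbol N q i \<theta>)) [0..<N]) \<in> mps_space N"
    by (rule mps_space_prod)
      (auto simp: x_check_symbol_def intro!: mps_space_subst mps_space_scale mps_space_var)
  have "x_check_symbol N q i \<theta> (\<lambda>_. 0) = 0" for i
    by (auto simp: x_check_symbol_def mps_scale_def mps_var_def fun_eq_iff)
  thus "mps_prod (map (\<lambda>i. mps_subst (inverse (phi q)) (x_check_symbol N q i \<theta>)) [0..<N]) (\<lambda>_. 0) = 1"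
    by (simp add: mps_prod_zero mps_subst_zero o_def map_replicate_const prod_list_replicate)
qed

end

theory Submission
  imports Defs
begin

text \<open>
  The normal ordered monomials \<open>:x\<^sup>\<mu>:\<close> multiply up to powers of \<open>q\<close>, with exponent the bilinear form
  \<open>\<beta>(\<mu>, \<nu>) = \<Sum>\<^sub>i \<mu>\<^sub>i (\<nu>\<^sub>i - \<nu>\<^sub>i\<^sub>-\<^sub>1)\<close>, so that all operators live in one twisted power series algebra and
  \<open>e\<^sub>q(-x)\<close> becomes \<open>:\<phi>(x):\<close> there. In the right block, \<open>\<phi>(q\<^sup>1\<^sup>-\<^sup>N D \<Lambda>)\<close> is central and equals \<open>\<phi>(x\<^sub>N\<^sub>-\<^sub>1 \<dots> x\<^sub>0)\<close>.
  Starting from it, the pentagon identity peels off \<open>x\<^sub>N\<^sub>-\<^sub>1, \<dots>, x\<^sub>1\<close> one after the other: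
  surrounding \<open>:\<phi>(x\<^sub>j \<dots> x\<^sub>0) \<phi>(x\<^sub>j\<^sub>+\<^sub>1) \<dots> \<phi>(x\<^sub>N\<^sub>-\<^sub>1):\<close> by \<open>e\<^sub>q(-x\<^sub>j)\<close> and \<open>e\<^sub>q(-x\<^sub>j\<^sub>-\<^sub>1 \<dots> x\<^sub>0)\<close> gives the
  same expression with \<open>j - 1\<close> in place of \<open>j\<close>. This only needs that \<open>q\<close> is not a root of unity. The
  inverse of the left block is therefore the same identity for \<open>q\<^sup>-\<^sup>1\<close> and \<open>d\<^sub>i d\<^sub>i' = q\<^sup>-\<^sup>1\<close>, since
  \<open>\<phi>\<close> for \<open>q\<^sup>-\<^sup>1\<close> at \<open>z\<close> is \<open>e\<^sub>q(qz)\<close>.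
\<close>

section \<open>A finite sum identity\<close>

text \<open>The binomial coefficient \<open>n choose 2\<close>. It is both the Gaussian exponent in
  the coefficients of \<open>phi\<close> and the number of pairs reordered when an
  \<open>n\<close>-th power is put in normal order; this coincidence turns \<open>e_q\<close> into
  \<open>phi\<close>.\<close>

definition tri :: "nat \<Rightarrow> nat" where
  "tri n = n * (n - 1) div 2"

lemma tri_simps [simp]: "tri 0 = 0" "tri (Suc n) = tri n + n"
proof -
  show "tri (Suc n) = tri n + n"
    by (cases n) (auto simp: tri_def algebra_simps)
qed (simp add: tri_def)

lemma tri_add: "tri (m + n) = tri m + tri n + m * n"
  by (induction n) auto

lemma phi_nth: "phi q $ n = q ^ tri n * (-1) ^ n / q_fact q n"
  by (simp add: phi_def tri_def)

text \<open>Excludes roots of unity instead of bounding \<open>norm q\<close>, because the sum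
  identities are also applied with \<open>inverse q\<close> in place of \<open>q\<close>.\<close>

lemma q_fact_neq_0_generic:
  assumes "\<And>n. n > 0 \<Longrightarrow> q ^ n \<noteq> (1 :: complex)"
  shows "q_fact q n \<noteq> 0"
  using assms by (auto simp: q_fact_def Suc_le_eq)

text \<open>A limiting case of the q-Chu-Vandermonde sum, by induction on \<open>M\<close> for all
  \<open>B\<close> at once: multiplication by \<open>1 - q ^ Suc M\<close> produces the sums for
  \<open>(M, B)\<close> and \<open>(M, B - 1)\<close>.\<close>

lemma q_binomial_inversion:
  assumes q: "\<And>n. n > 0 \<Longrightarrow> q ^ n \<noteq> (1 :: complex)"
  shows "(\<Sum>k\<le>M. if k \<le> B then (-1) ^ k * q ^ tri k / (q_fact q k * q_fact q (M - k) * q_fact q (B - k)) else 0)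
         = q ^ (M * B) / (q_fact q M * q_fact q B)"
proof (induction M arbitrary: B)
  case 0
  then show ?case by simp
next
  case (Suc M)
  \<comment> \<open>The guard \<open>k \<le> M\<close> makes \<open>t M B (Suc M)\<close> vanish, so
    that relation \<open>a\<close> also holds at \<open>k = Suc M\<close>, where its factor
    \<open>1 - q ^ 0\<close> is zero.\<close>
  define t where "t M B k = (if k \<le> M \<and> k \<le> B then
     (-1) ^ k * q ^ tri k / (q_fact q k * q_fact q (M - k) * q_fact q (B - k)) else 0)" for M B k
  have IH: "(\<Sum>k\<le>M. t M B k) = q ^ (M * B) / (q_fact q M * q_fact q B)" for B
    using Suc.IH[of B] by (simp add: t_def)
  note nz = q_fact_neq_0_generic[OF q]
  have nz': "1 - q ^ Suc k \<noteq> 0" for k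
    using q[of "Suc k"] by auto
  have a: "(1 - q ^ (Suc M - k)) * t (Suc M) B k = t M B k" if "k \<le> Suc M" for k
  proof (cases "k \<le> M")
    case True
    then have "Suc M - k = Suc (M - k)" by simp
    then show ?thesis using True nz nz'[of "M - k"]
      by (simp add: t_def q_fact_Suc del: power_Suc)
  qed (use that in \<open>auto simp: t_def\<close>)
  have b: "(1 - q ^ Suc k) * q ^ (M - k) * t (Suc M) (Suc B) (Suc k) = - (q ^ M * t M B k)"
    if "k \<le> M" for k B
  proof -
    have "q ^ M = q ^ (M - k) * q ^ k"
      using that by (simp flip: power_add)
    then show ?thesis using that nz nz'[of k]
      by (simp add: t_def q_fact_Suc power_add del: power_Suc) (simp add: field_simps)
  qed
  \<comment> \<open>The split is \<open>1 - q^(M+1) = (1 - q^(M+1-k)) + (1 - q^k) q^(M+1-k)\<close>.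
    The first part lowers \<open>M\<close> alone; the second, after a shift of \<open>k\<close>,
    lowers both \<open>M\<close> and \<open>B\<close>.\<close>
  have "(1 - q ^ Suc M) * (\<Sum>k\<le>Suc M. t (Suc M) B k)
      = (\<Sum>k\<le>Suc M. (1 - q ^ (Suc M - k)) * t (Suc M) B k + (1 - q ^ k) * q ^ (Suc M - k) * t (Suc M) B k)"
    unfolding sum_distrib_left
  proof (rule sum.cong[OF refl])
    fix k assume "k \<in> {..Suc M}"
    then have "q ^ Suc M = q ^ (Suc M - k) * q ^ k"
      by (simp flip: power_add)
    then show "(1 - q ^ Suc M) * t (Suc M) B k
      = (1 - q ^ (Suc M - k)) * t (Suc M) B k + (1 - q ^ k) * q ^ (Suc M - k) * t (Suc M) B k"
      by (simp add: algebra_simps)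
  qed
  also have "\<dots> = (\<Sum>k\<le>Suc M. t M B k) + (\<Sum>k\<le>Suc M. (1 - q ^ k) * q ^ (Suc M - k) * t (Suc M) B k)"
    unfolding sum.distrib by (intro arg_cong2[of _ _ _ _ "(+)"] sum.cong refl a) simp
  also have "(\<Sum>k\<le>Suc M. t M B k) = (\<Sum>k\<le>M. t M B k)"
    by (simp add: t_def)
  also have "(\<Sum>k\<le>Suc M. (1 - q ^ k) * q ^ (Suc M - k) * t (Suc M) B k)
      = (\<Sum>k\<le>M. (1 - q ^ Suc k) * q ^ (M - k) * t (Suc M) B (Suc k))"
    by (subst sum.atMost_Suc_shift) simp
  finally have rec: "(1 - q ^ Suc M) * (\<Sum>k\<le>Suc M. t (Suc M) B k)
      = (\<Sum>k\<le>M. t M B k) + (\<Sum>k\<le>M. (1 - q ^ Suc k) * q ^ (M - k) * t (Suc M) B (Suc k))" .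
  have "(1 - q ^ Suc M) * (\<Sum>k\<le>Suc M. t (Suc M) B k) = q ^ (Suc M * B) / (q_fact q M * q_fact q B)"
  proof (cases B)
    case 0
    then show ?thesis using rec IH[of 0] by (simp add: t_def)
  next
    case (Suc C)
    have "(\<Sum>k\<le>M. (1 - q ^ Suc k) * q ^ (M - k) * t (Suc M) B (Suc k)) = - (q ^ M * (\<Sum>k\<le>M. t M C k))"
      unfolding Suc sum_distrib_left sum_negf[symmetric] by (intro sum.cong refl b) simp
    then show ?thesis using rec IH[of B] IH[of C] nz[of M] nz[of C] nz'[of C]
      by (simp add: Suc q_fact_Suc del: power_Suc) (simp add: divide_simps power_add algebra_simps)
  qed
  then have *: "(\<Sum>k\<le>Suc M. t (Suc M) B k) = q ^ (Suc M * B) / (q_fact q (Suc M) * q_fact q B)"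
    using nz'[of M] nz by (simp add: q_fact_Suc field_simps del: power_Suc sum.atMost_Suc)
  have "(\<Sum>k\<le>Suc M. t (Suc M) B k) = (\<Sum>k\<le>Suc M. if k \<le> B then
      (-1) ^ k * q ^ tri k / (q_fact q k * q_fact q (Suc M - k) * q_fact q (B - k)) else 0)"
    by (intro sum.cong refl) (simp add: t_def)
  with * show ?case by simp
qed


text \<open>Coefficient form of the pentagon identity. Once the coefficients of \<open>phi\<close>
  are inserted, all signs and powers of \<open>q\<close> except \<open>(-1) ^ k * q ^ tri k\<close>
  collect into a factor free of \<open>k\<close>, which leaves the sum of
  \<open>q_binomial_inversion\<close>.\<close>

lemma phi_convolution:
  assumes q: "\<And>n. n > 0 \<Longrightarrow> q ^ n \<noteq> (1 :: complex)" and q0: "q \<noteq> 0"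
  shows "(\<Sum>k\<le>M. if k \<le> B then phi q $ (M - k) * phi q $ k * phi q $ (B - k) *
            q powi (- int (k + (M - k) * (B - k))) else 0) = phi q $ M * phi q $ B"
proof -
  define C where "C = (-1) ^ (M + B) * q ^ (tri M + tri B) / q ^ (M * B)"
  have term_eq: "phi q $ (M - k) * phi q $ k * phi q $ (B - k) * q powi (- int (k + (M - k) * (B - k)))
      = C * ((-1) ^ k * q ^ tri k / (q_fact q k * q_fact q (M - k) * q_fact q (B - k)))"
    if "k \<le> M" "k \<le> B" for k
  proof -
    from that obtain m b where mb: "M = k + m" "B = k + b"
      by (metis le_Suc_ex)
    \<comment> \<open>The product \<open>M * B\<close> contains \<open>k * k\<close>; this trades it
      for the two copies of \<open>tri k\<close> inside \<open>tri M + tri B\<close> and the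
      \<open>k\<close> in the exponent.\<close>
    have "2 * tri k + k = k * k"
      by (induction k) auto
    then have "tri m + tri k + tri b + M * B = (tri M + tri B + tri k) + (k + m * b)"
      by (simp add: mb tri_add algebra_simps)
    then have "q ^ tri m * q ^ tri k * q ^ tri b * q ^ (M * B)
      = q ^ (tri M + tri B) * q ^ tri k * q ^ (k + m * b)"
      by (metis power_add)
    then have e: "q ^ tri m * q ^ tri k * q ^ tri b / q ^ (k + m * b)
      = q ^ (tri M + tri B) / q ^ (M * B) * q ^ tri k"
      using q0 by (simp add: field_simps)
    have s: "(-1) ^ m * (-1) ^ k * (-1) ^ b = (-1) ^ (M + B) * ((-1) ^ k :: complex)"
      by (simp add: mb power_add)
    have "phi q $ m * phi q $ k * phi q $ b * q powi (- int (k + m * b))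
      = (q ^ tri m * q ^ tri k * q ^ tri b / q ^ (k + m * b)) * ((-1) ^ m * (-1) ^ k * (-1) ^ b)
         / (q_fact q k * q_fact q m * q_fact q b)"
      by (simp only: phi_nth power_int_minus power_int_of_nat) (simp add: divide_inverse mult_ac)
    also have "\<dots> = C * ((-1) ^ k * q ^ tri k / (q_fact q k * q_fact q m * q_fact q b))"
      unfolding e s by (simp add: C_def)
    finally show ?thesis by (simp add: mb)
  qed
  have "(\<Sum>k\<le>M. if k \<le> B then phi q $ (M - k) * phi q $ k * phi q $ (B - k) *
            q powi (- int (k + (M - k) * (B - k))) else 0)
      = C * (\<Sum>k\<le>M. if k \<le> B then (-1) ^ k * q ^ tri k / (q_fact q k * q_fact q (M - k) * q_fact q (B - k)) else 0)"
    unfolding sum_distrib_left by (intro sum.cong refl) (simp add: term_eq del: of_nat_add of_nat_mult)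
  also have "\<dots> = phi q $ M * phi q $ B"
    using q0 by (simp add: q_binomial_inversion[OF q] C_def phi_nth power_add)
  finally show ?thesis .
qed


section \<open>Twisted products of power series\<close>

text \<open>
  A sum over \<open>{..\<mu>}\<close> is \<open>0\<close> when this set is infinite, so operators given by such sums have values
  in \<open>tame\<close>, and act as expected on it.
\<close>

definition tame :: "mps set" where
  "tame = {f. \<forall>\<mu>. infinite {..\<mu>} \<longrightarrow> f \<mu> = 0}"

lemma mps_space_subset_tame: "mps_space N \<subseteq> tame"
  using finite_atMost_exponent by (auto simp: mps_space_def tame_def)

lemma finite_atMost_support:
  assumes "finite A" "\<And>i. i \<notin> A \<Longrightarrow> \<mu> i = 0"
  shows "finite {..\<mu> :: exponent}"
proof (rule finite_atMost_exponent)
  show "\<mu> \<in> exponents (Suc (Max (insert 0 A)))"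
    unfolding exponents_def
  proof (intro CollectI allI impI)
    fix i assume i: "Suc (Max (insert 0 A)) \<le> i"
    have "i \<le> Max (insert 0 A)" if "i \<in> A"
      using that assms(1) by (intro Max_ge) auto
    then show "\<mu> i = 0" using i assms(2) by fastforce
  qed
qed

lemma sum_atMost_reflect:
  fixes \<mu> :: exponent
  shows "(\<Sum>\<nu>\<in>{..\<mu>}. g \<nu> (\<mu> - \<nu>)) = (\<Sum>\<nu>\<in>{..\<mu>}. g (\<mu> - \<nu>) \<nu>)"
  by (rule sum.reindex_bij_witness[of _ "\<lambda>\<nu>. \<mu> - \<nu>" "\<lambda>\<nu>. \<mu> - \<nu>"]) (auto simp: le_fun_def fun_diff_def)

definition smul :: "nat \<Rightarrow> exponent \<Rightarrow> exponent" where
  "smul n s = (\<lambda>i. n * s i)"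

definition mon :: "complex \<Rightarrow> exponent \<Rightarrow> mps" where
  "mon z s = (\<lambda>\<mu>. if \<mu> = s then z else 0)"

text \<open>The series with terms \<open>G n * x^(n s)\<close>. The sum merely inverts the map from
  \<open>n\<close> to \<open>n s\<close>: when \<open>s\<close> has an entry 1, it has at most one
  term.\<close>

definition ray :: "(nat \<Rightarrow> complex) \<Rightarrow> exponent \<Rightarrow> mps" where
  "ray G s = (\<lambda>\<mu>. \<Sum>n | smul n s = \<mu>. G n)"

definition unit_exp :: "nat \<Rightarrow> exponent" where
  "unit_exp j = (\<lambda>i. if i = j then 1 else 0)"

text \<open>The exponent of \<open>x_0 ... x_(m-1)\<close>; \<open>seg N\<close> is that of
  \<Lambda>.\<close>

definition seg :: "nat \<Rightarrow> exponent" where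
  "seg m = (\<lambda>i. if i < m then 1 else 0)"

lemma ray_smul:
  assumes "s p = 1"
  shows "ray G s (smul n s) = G n"
proof -
  have "{m. smul m s = smul n s} = {n}"
    using assms by (auto simp: smul_def dest: fun_cong[of _ _ p])
  then show ?thesis by (simp add: ray_def)
qed

lemma ray_zero: "(\<And>n. \<mu> \<noteq> smul n s) \<Longrightarrow> ray G s \<mu> = 0"
  unfolding ray_def by (rule sum.neutral) auto

text \<open>An index \<open>p\<close> with \<open>s p = 1\<close> allows the multiplicity to be read
  off as \<open>\<mu> p\<close>.\<close>

lemma ray_eq:
  assumes "s p = 1"
  shows "ray G s \<mu> = (if \<mu> = smul (\<mu> p) s then G (\<mu> p) else 0)"
proof (cases "\<mu> = smul (\<mu> p) s")
  case True
  then show ?thesis using ray_smul[of s p G "\<mu> p"] assms by simp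
next
  case False
  have "\<mu> \<noteq> smul n s" for n
    using False assms by (auto simp: smul_def)
  then show ?thesis using False ray_zero by simp
qed

text \<open>Only multiples of \<open>s\<close> contribute. The guard stays because other coordinates
  of \<open>\<mu>\<close> may bound \<open>k\<close> more tightly than
  \<open>\<mu> p\<close>.\<close>

lemma sum_ray:
  assumes "s p = 1" "finite {..\<mu>}"
  shows "(\<Sum>\<nu>\<in>{..\<mu>}. ray G s \<nu> * h \<nu>) = (\<Sum>k\<le>\<mu> p. if smul k s \<le> \<mu> then G k * h (smul k s) else 0)"
proof -
  define K where "K = {k. k \<le> \<mu> p \<and> smul k s \<le> \<mu>}"
  have "(\<Sum>k\<le>\<mu> p. if smul k s \<le> \<mu> then G k * h (smul k s) else 0) = (\<Sum>k\<in>K. G k * h (smul k s))"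
    unfolding K_def by (subst sum.inter_filter[symmetric]) auto
  also have "\<dots> = (\<Sum>k\<in>K. ray G s (smul k s) * h (smul k s))"
    using ray_smul[where s = s and p = p, OF assms(1)] by simp
  also have "\<dots> = (\<Sum>\<nu>\<in>(\<lambda>k. smul k s) ` K. ray G s \<nu> * h \<nu>)"
  proof (subst sum.reindex)
    show "inj_on (\<lambda>k. smul k s) K"
      using assms(1) by (auto simp: inj_on_def smul_def dest: fun_cong[of _ _ p])
  qed simp
  also have "\<dots> = (\<Sum>\<nu>\<in>{..\<mu>}. ray G s \<nu> * h \<nu>)"
  proof (rule sum.mono_neutral_left)
    show "\<forall>\<nu>\<in>{..\<mu>} - (\<lambda>k. smul k s) ` K. ray G s \<nu> * h \<nu> = 0"
    proof
      fix \<nu> assume nu: "\<nu> \<in> {..\<mu>} - (\<lambda>k. smul k s) ` K"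
      have "\<nu> \<noteq> smul k s" for k
      proof
        assume k: "\<nu> = smul k s"
        then have "\<nu> p = k" using assms(1) by (simp add: smul_def)
        moreover have "\<nu> \<le> \<mu>" using nu by simp
        ultimately have "k \<in> K" using k le_funD[of \<nu> \<mu> p] by (simp add: K_def)
        then show False using nu k by auto
      qed
      then show "ray G s \<nu> * h \<nu> = 0" by (simp add: ray_zero)
    qed
  qed (use assms(2) in \<open>auto simp: K_def\<close>)
  finally show ?thesis by simp
qed

lemma sum_mon:
  assumes "finite {..\<mu>}"
  shows "(\<Sum>\<nu>\<in>{..\<mu>}. mon z s \<nu> * h \<nu>) = (if s \<le> \<mu> then z * h s else 0)"
proof -
  have "(\<Sum>\<nu>\<in>{..\<mu>}. mon z s \<nu> * h \<nu>) = (\<Sum>\<nu>\<in>{..\<mu>}. if \<nu> = s then z * h s else 0)"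
    by (intro sum.cong) (auto simp: mon_def)
  then show ?thesis using assms by simp
qed

lemma mps_var_eq_mon: "mps_var i = mon 1 (unit_exp i)"
  by (auto simp: mps_var_def mon_def unit_exp_def fun_eq_iff)

lemma unit_exp_self [simp]: "unit_exp j j = 1"
  by (simp add: unit_exp_def)

lemma seg_0: "m > 0 \<Longrightarrow> seg m 0 = 1"
  by (simp add: seg_def)

lemma op_prod_Cons: "op_prod (T # Ts) f = T (op_prod Ts f)"
  by (simp add: op_prod_def)

lemma op_prod_Nil: "op_prod [] f = f"
  by (simp add: op_prod_def)

lemma op_prod_append: "op_prod (Ts @ Us) f = op_prod Ts (op_prod Us f)"
  by (induction Ts) (simp_all add: op_prod_Cons op_prod_Nil)

section \<open>The operator algebra\<close>

text \<open>Used at \<open>q\<close> with weights \<open>d i * db i\<close> and at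
  \<open>inverse q\<close> with constant weight \<open>inverse q\<close>. The second parameter has
  norm above 1, so the assumption concerns roots of unity and not size.\<close>

locale quantum_torus =
  fixes N :: nat and q :: complex and a :: "nat \<Rightarrow> complex"
  assumes N: "N \<ge> 2" and q0: "q \<noteq> 0" and q1: "\<And>n. n > 0 \<Longrightarrow> q ^ n \<noteq> 1"
begin

definition beta :: "exponent \<Rightarrow> exponent \<Rightarrow> int" where
  "beta \<mu> \<nu> = (\<Sum>i<N. int (\<mu> i) * (int (\<nu> i) - int (\<nu> (cyc_pred N i))))"

definition wt :: "exponent \<Rightarrow> complex" where
  "wt \<mu> = (\<Prod>i<N. a i ^ \<mu> i)"

text \<open>\<open>Op c = :\<Sum>\<^sub>\<mu> c\<^sub>\<mu> x\<^sup>\<mu>:\<close> with \<open>a\<^sub>i x\<^sub>i q\<^bsup>\<theta>\<^sub>i - \<theta>\<^sub>i\<^sub>-\<^sub>1\<^esup>\<close> for \<open>x\<^sub>i\<close>.\<close>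

definition Op :: "mps \<Rightarrow> mps \<Rightarrow> mps" where
  "Op c f = (\<lambda>\<mu>. \<Sum>\<nu>\<in>{..\<mu>}. c \<nu> * (wt \<nu> * q powi beta \<nu> (\<mu> - \<nu>) * f (\<mu> - \<nu>)))"

text \<open>The product of symbols that corresponds to composition. The weights are absent:
  \<open>wt\<close> is multiplicative and can stay in \<open>Op\<close>.\<close>

definition star :: "mps \<Rightarrow> mps \<Rightarrow> mps" where
  "star c c' = (\<lambda>\<mu>. \<Sum>\<nu>\<in>{..\<mu>}. c \<nu> * (c' (\<mu> - \<nu>) * q powi beta \<nu> (\<mu> - \<nu>)))"

lemma beta_diff_left: "\<sigma> \<le> \<mu> \<Longrightarrow> beta (\<mu> - \<sigma>) \<rho> = beta \<mu> \<rho> - beta \<sigma> \<rho>"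
  unfolding beta_def sum_subtractf[symmetric]
  by (intro sum.cong refl) (simp add: le_fun_def of_nat_diff algebra_simps)

lemma beta_diff_right: "\<sigma> \<le> \<mu> \<Longrightarrow> beta \<rho> (\<mu> - \<sigma>) = beta \<rho> \<mu> - beta \<rho> \<sigma>"
  unfolding beta_def sum_subtractf[symmetric]
  by (intro sum.cong refl) (simp add: le_fun_def of_nat_diff algebra_simps)

lemma beta_smul_left: "beta (smul n s) \<rho> = int n * beta s \<rho>"
  by (simp add: beta_def smul_def sum_distrib_left mult.assoc)

lemma beta_smul_right: "beta \<rho> (smul n s) = int n * beta \<rho> s"
  by (simp add: beta_def smul_def sum_distrib_left algebra_simps)

lemma wt_diff: "\<sigma> \<le> \<mu> \<Longrightarrow> wt \<sigma> * wt (\<mu> - \<sigma>) = wt \<mu>"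
  unfolding wt_def prod.distrib[symmetric]
  by (intro prod.cong refl) (simp add: le_fun_def flip: power_add)

lemma Op_tame: "Op c f \<in> tame"
  by (simp add: Op_def tame_def)

text \<open>Over an infinite down-set the sum in \<open>Op\<close> is 0, and everything below an
  exponent with finite down-set has a finite one too.\<close>

lemma Op_cong: "(\<And>\<nu>. finite {..\<nu>} \<Longrightarrow> c \<nu> = c' \<nu>) \<Longrightarrow> Op c f = Op c' f"
proof
  fix \<mu> assume eq: "\<And>\<nu>. finite {..\<nu>} \<Longrightarrow> c \<nu> = c' \<nu>"
  show "Op c f \<mu> = Op c' f \<mu>"
  proof (cases "finite {..\<mu>}")
    case True
    have "c \<nu> = c' \<nu>" if "\<nu> \<le> \<mu>" for \<nu>
      using that by (intro eq finite_subset[OF _ True]) auto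
    then show ?thesis unfolding Op_def by (intro sum.cong) auto
  qed (simp add: Op_def)
qed

text \<open>The double sum is regrouped by the total exponent
  \<open>\<kappa> = \<nu> + \<rho>\<close>; bilinearity of \<open>beta\<close> gives the cocycle
  identity that matches the powers of \<open>q\<close>.\<close>

lemma Op_Op: "Op c (Op c' f) = Op (star c c') f"
proof
  fix \<mu>
  show "Op c (Op c' f) \<mu> = Op (star c c') f \<mu>"
  proof (cases "finite {..\<mu>}")
    case True
    have fin: "finite {..\<nu>}" if "\<nu> \<le> \<mu>" for \<nu>
      using that by (intro finite_subset[OF _ True]) auto
    have dle: "\<mu> - \<nu> \<le> \<mu>" for \<nu> by (simp add: le_fun_def)
    have "Op c (Op c' f) \<mu> = (\<Sum>\<nu>\<in>{..\<mu>}. \<Sum>\<rho>\<in>{..\<mu> - \<nu>}.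
        c \<nu> * c' \<rho> * (wt \<nu> * wt \<rho>) * (q powi beta \<nu> (\<mu> - \<nu>) * q powi beta \<rho> (\<mu> - \<nu> - \<rho>)) * f (\<mu> - \<nu> - \<rho>))"
      by (simp add: Op_def sum_distrib_left mult_ac)
    also have "\<dots> = (\<Sum>(\<nu>, \<rho>)\<in>(SIGMA \<nu>:{..\<mu>}. {..\<mu> - \<nu>}).
        c \<nu> * c' \<rho> * (wt \<nu> * wt \<rho>) * (q powi beta \<nu> (\<mu> - \<nu>) * q powi beta \<rho> (\<mu> - \<nu> - \<rho>)) * f (\<mu> - \<nu> - \<rho>))"
      by (subst sum.Sigma) (auto intro: True fin dle)
    also have "\<dots> = (\<Sum>(\<kappa>, \<nu>)\<in>(SIGMA \<kappa>:{..\<mu>}. {..\<kappa>}).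
        c \<nu> * c' (\<kappa> - \<nu>) * wt \<kappa> * (q powi beta \<nu> (\<kappa> - \<nu>) * q powi beta \<kappa> (\<mu> - \<kappa>)) * f (\<mu> - \<kappa>))"
    proof (rule sum.reindex_bij_witness[of _ "\<lambda>(\<kappa>, \<nu>). (\<nu>, \<kappa> - \<nu>)" "\<lambda>(\<nu>, \<rho>). (\<lambda>i. \<nu> i + \<rho> i, \<nu>)"])
      fix x assume "x \<in> (SIGMA \<nu>:{..\<mu>}. {..\<mu> - \<nu>})"
      then obtain \<nu> \<rho> where x: "x = (\<nu>, \<rho>)" and le: "\<nu> \<le> \<mu>" "\<rho> \<le> \<mu> - \<nu>" by auto
      define \<kappa> where "\<kappa> = (\<lambda>i. \<nu> i + \<rho> i)"
      have k: "\<kappa> \<le> \<mu>" "\<nu> \<le> \<kappa>" and rho: "\<rho> = \<kappa> - \<nu>" and mu: "\<mu> - \<nu> - \<rho> = \<mu> - \<kappa>"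
        using le by (auto simp: \<kappa>_def le_fun_def fun_eq_iff) (metis Nat.le_diff_conv2 add.commute)
      have w: "wt \<nu> * wt \<rho> = wt \<kappa>" unfolding rho by (rule wt_diff[OF k(2)])
      have b: "beta \<nu> (\<mu> - \<nu>) + beta \<rho> (\<mu> - \<kappa>) = beta \<nu> (\<kappa> - \<nu>) + beta \<kappa> (\<mu> - \<kappa>)"
        unfolding rho using k le(1) by (simp add: beta_diff_left beta_diff_right)
      have "q powi beta \<nu> (\<mu> - \<nu>) * q powi beta \<rho> (\<mu> - \<kappa>) = q powi beta \<nu> (\<kappa> - \<nu>) * q powi beta \<kappa> (\<mu> - \<kappa>)"
        using b q0 by (simp flip: power_int_add)
      then show "(case case x of (\<nu>, \<rho>) \<Rightarrow> (\<lambda>i. \<nu> i + \<rho> i, \<nu>) of (\<kappa>, \<nu>) \<Rightarrow>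
          c \<nu> * c' (\<kappa> - \<nu>) * wt \<kappa> * (q powi beta \<nu> (\<kappa> - \<nu>) * q powi beta \<kappa> (\<mu> - \<kappa>)) * f (\<mu> - \<kappa>))
        = (case x of (\<nu>, \<rho>) \<Rightarrow>
          c \<nu> * c' \<rho> * (wt \<nu> * wt \<rho>) * (q powi beta \<nu> (\<mu> - \<nu>) * q powi beta \<rho> (\<mu> - \<nu> - \<rho>)) * f (\<mu> - \<nu> - \<rho>))"
        unfolding x prod.case mu w \<kappa>_def[symmetric] rho[symmetric] by simp
      show "(case x of (\<nu>, \<rho>) \<Rightarrow> (\<lambda>i. \<nu> i + \<rho> i, \<nu>)) \<in> (SIGMA \<kappa>:{..\<mu>}. {..\<kappa>})"
        using k by (simp add: x \<kappa>_def)
      show "(case case x of (\<nu>, \<rho>) \<Rightarrow> (\<lambda>i. \<nu> i + \<rho> i, \<nu>) of (\<kappa>, \<nu>) \<Rightarrow> (\<nu>, \<kappa> - \<nu>)) = x"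
        by (auto simp: x fun_eq_iff)
    next
      fix x assume "x \<in> (SIGMA \<kappa>:{..\<mu>}. {..\<kappa>})"
      then obtain \<kappa> \<nu> where x: "x = (\<kappa>, \<nu>)" and le: "\<kappa> \<le> \<mu>" "\<nu> \<le> \<kappa>" by auto
      show "(case x of (\<kappa>, \<nu>) \<Rightarrow> (\<nu>, \<kappa> - \<nu>)) \<in> (SIGMA \<nu>:{..\<mu>}. {..\<mu> - \<nu>})"
        using le by (auto simp: x le_fun_def diff_le_mono intro: order_trans)
      show "(case case x of (\<kappa>, \<nu>) \<Rightarrow> (\<nu>, \<kappa> - \<nu>) of (\<nu>, \<rho>) \<Rightarrow> (\<lambda>i. \<nu> i + \<rho> i, \<nu>)) = x"
        using le by (auto simp: x fun_eq_iff le_fun_def)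
    qed
    also have "\<dots> = (\<Sum>\<kappa>\<in>{..\<mu>}. \<Sum>\<nu>\<in>{..\<kappa>}.
        c \<nu> * c' (\<kappa> - \<nu>) * wt \<kappa> * (q powi beta \<nu> (\<kappa> - \<nu>) * q powi beta \<kappa> (\<mu> - \<kappa>)) * f (\<mu> - \<kappa>))"
      by (subst sum.Sigma) (auto intro: True fin)
    also have "\<dots> = Op (star c c') f \<mu>"
      by (simp add: Op_def star_def sum_distrib_left sum_distrib_right mult_ac)
    finally show ?thesis .
  qed (simp add: Op_def)
qed

lemma Op_one: "f \<in> tame \<Longrightarrow> Op (mon 1 (\<lambda>_. 0)) f = f"
proof
  fix \<mu> assume f: "f \<in> tame"
  show "Op (mon 1 (\<lambda>_. 0)) f \<mu> = f \<mu>"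
  proof (cases "finite {..\<mu>}")
    case True
    then show ?thesis
      by (simp add: Op_def sum_mon) (simp add: le_fun_def wt_def beta_def fun_diff_def)
  qed (use f in \<open>simp add: Op_def tame_def\<close>)
qed

lemma star_mon:
  assumes "finite {..\<mu>}"
  shows "star (mon z s) (mon w t) \<mu> = mon (z * w * q powi beta s t) (\<lambda>i. s i + t i) \<mu>"
proof -
  have "s \<le> \<mu> \<and> \<mu> - s = t \<longleftrightarrow> \<mu> = (\<lambda>i. s i + t i)"
    by (auto simp: le_fun_def fun_eq_iff) (metis le_add_diff_inverse)
  then show ?thesis unfolding star_def sum_mon[OF assms] by (auto simp: mon_def)
qed

lemma Op_mon_mon: "Op (mon z s) (Op (mon w t) f) = Op (mon (z * w * q powi beta s t) (\<lambda>i. s i + t i)) f"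
  unfolding Op_Op by (rule Op_cong) (rule star_mon)

text \<open>Each pair of factors contributes \<open>beta s s\<close> on reordering, and
  \<open>n\<close> factors have \<open>tri n\<close> pairs. Knowing \<open>T\<close> on
  \<open>tame\<close> is enough because \<open>Op\<close> maps into \<open>tame\<close>.\<close>

lemma funpow_mon:
  assumes "\<And>g. g \<in> tame \<Longrightarrow> T g = Op (mon z s) g" "f \<in> tame"
  shows "(T ^^ n) f = Op (mon (z ^ n * q powi (beta s s * int (tri n))) (smul n s)) f"
proof (induction n)
  case 0
  then show ?case using Op_one[OF assms(2)] by (simp add: smul_def)
next
  case (Suc n)
  have "(T ^^ Suc n) f = Op (mon z s) (Op (mon (z ^ n * q powi (beta s s * int (tri n))) (smul n s)) f)"
    by (simp add: Suc assms(1)[OF Op_tame])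
  also have "\<dots> = Op (mon (z ^ Suc n * q powi (beta s s * int (tri (Suc n)))) (smul (Suc n) s)) f"
    unfolding Op_mon_mon
    by (rule arg_cong[where f = "\<lambda>c. Op c f"], rule arg_cong2[where f = mon])
      (use q0 in \<open>auto simp: fun_eq_iff smul_def beta_smul_right[unfolded smul_def] power_int_add algebra_simps\<close>)
  finally show ?case .
qed

lemma op_series_mon:
  assumes T: "\<And>g. g \<in> tame \<Longrightarrow> T g = Op (mon z s) g" and f: "f \<in> tame" and p: "s p = 1"
  shows "op_series F T f = Op (ray (\<lambda>n. F $ n * z ^ n * q powi (beta s s * int (tri n))) s) f"
proof
  fix \<mu>
  let ?G = "\<lambda>n. z ^ n * q powi (beta s s * int (tri n))"
  show "op_series F T f \<mu> = Op (ray (\<lambda>n. F $ n * z ^ n * q powi (beta s s * int (tri n))) s) f \<mu>"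
  proof (cases "finite {..\<mu>}")
    case True
    let ?h = "\<lambda>\<nu>. wt \<nu> * q powi beta \<nu> (\<mu> - \<nu>) * f (\<mu> - \<nu>)"
    have t: "(T ^^ n) f \<mu> = (if smul n s \<le> \<mu> then ?G n * ?h (smul n s) else 0)" for n
      by (simp only: funpow_mon[OF T f] Op_def sum_mon[OF True])
    \<comment> \<open>The series terminates: as \<open>s p = 1\<close>, the exponent
      \<open>n s\<close> exceeds \<open>\<mu>\<close> at \<open>p\<close> once
      \<open>n > \<mu> p\<close>.\<close>
    have "op_series F T f \<mu> = (\<Sum>n\<le>\<mu> p. F $ n * (T ^^ n) f \<mu>)"
      unfolding op_series_def
    proof (rule suminf_finite)
      fix n assume "n \<notin> {..\<mu> p}"
      then have "\<not> smul n s \<le> \<mu>"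
        using p by (auto simp: le_fun_def smul_def intro!: exI[of _ p])
      then show "F $ n * (T ^^ n) f \<mu> = 0" by (simp add: t)
    qed simp
    also have "\<dots> = (\<Sum>n\<le>\<mu> p. if smul n s \<le> \<mu> then F $ n * z ^ n * q powi (beta s s * int (tri n)) * ?h (smul n s) else 0)"
      unfolding t by (intro sum.cong refl) auto
    finally show ?thesis by (simp only: Op_def sum_ray[where s = s and p = p, OF p True])
  qed (simp add: op_series_def funpow_mon[OF T f] Op_def)
qed

lemma star_ray_left:
  assumes "s p = 1" "finite {..\<mu>}"
  shows "star (ray G s) c \<mu> = (\<Sum>k\<le>\<mu> p. if smul k s \<le> \<mu> then
           G k * (c (\<mu> - smul k s) * q powi beta (smul k s) (\<mu> - smul k s)) else 0)"
  unfolding star_def by (rule sum_ray[where s = s and p = p, OF assms])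

lemma star_ray_right:
  assumes "s p = 1" "finite {..\<mu>}"
  shows "star c (ray G s) \<mu> = (\<Sum>k\<le>\<mu> p. if smul k s \<le> \<mu> then
           G k * (c (\<mu> - smul k s) * q powi beta (\<mu> - smul k s) (smul k s)) else 0)"
proof -
  have "star c (ray G s) \<mu> = (\<Sum>\<nu>\<in>{..\<mu>}. ray G s \<nu> * (c (\<mu> - \<nu>) * q powi beta (\<mu> - \<nu>) \<nu>))"
    unfolding star_def
    by (subst sum_atMost_reflect[of "\<lambda>\<nu> \<rho>. c \<nu> * (ray G s \<rho> * q powi beta \<nu> \<rho>)"]) (simp add: mult_ac)
  then show ?thesis by (simp only: sum_ray[where s = s and p = p, OF assms])
qed

lemma star_ray_ray:
  assumes p: "s p = 1" and fin: "finite {..\<mu>}"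
  shows "star (ray F s) (ray G s) \<mu>
       = ray (\<lambda>n. \<Sum>k\<le>n. F k * G (n - k) * q powi (beta s s * int (k * (n - k)))) s \<mu>"
proof (cases "\<exists>n. \<mu> = smul n s")
  case True
  then obtain n where n: "\<mu> = smul n s" by blast
  have "\<mu> p = n" using p by (simp add: n smul_def)
  have le: "smul k s \<le> \<mu>" and diff: "\<mu> - smul k s = smul (n - k) s" if "k \<le> n" for k
    using that by (auto simp: n smul_def le_fun_def fun_eq_iff diff_mult_distrib)
  show ?thesis
    unfolding star_ray_left[where s = s and p = p, OF assms] \<open>\<mu> p = n\<close>
    unfolding n ray_smul[where s = s and p = p, OF p]
    by (intro sum.cong refl)
      (simp add: le[unfolded n] diff[unfolded n] ray_smul[where s = s and p = p, OF p] beta_smul_left beta_smul_right mult_ac)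
next
  case False
  have "ray G s (\<mu> - smul k s) = 0" if "smul k s \<le> \<mu>" for k
  proof (rule ray_zero)
    fix n show "\<mu> - smul k s \<noteq> smul n s"
    proof
      assume eq: "\<mu> - smul k s = smul n s"
      have "\<mu> i = smul (n + k) s i" for i
        using fun_cong[OF eq, of i] le_funD[OF that, of i]
        by (simp add: smul_def distrib_right)
      then have "\<mu> = smul (n + k) s" by (rule ext)
      then show False using False by blast
    qed
  qed
  then have "star (ray F s) (ray G s) \<mu> = 0"
    unfolding star_ray_left[where s = s and p = p, OF assms] by (intro sum.neutral) auto
  then show ?thesis using False by (simp add: ray_zero)
qed

text \<open>By \<open>tri_add\<close> the reordering powers of the two factors complete to
  \<open>tri n\<close>, which is free of \<open>k\<close>. Series in one operator therefore multiply
  like ordinary power series.\<close>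

lemma op_series_inverse:
  assumes T: "\<And>g. g \<in> tame \<Longrightarrow> T g = Op (mon z s) g" and f: "f \<in> tame" and p: "s p = 1"
    and FG: "F * G = 1"
  shows "op_series F T (op_series G T f) = f"
proof -
  let ?R = "\<lambda>F n. F $ n * z ^ n * q powi (beta s s * int (tri n))"
  have "op_series F T (op_series G T f) = Op (star (ray (?R F) s) (ray (?R G) s)) f"
    by (simp only: op_series_mon[where s = s and p = p, OF T _ p] Op_tame f Op_Op)
  also have "\<dots> = Op (mon 1 (\<lambda>_. 0)) f"
  proof (rule Op_cong)
    fix \<nu> :: exponent assume fin: "finite {..\<nu>}"
    have "(\<Sum>k\<le>n. ?R F k * ?R G (n - k) * q powi (beta s s * int (k * (n - k)))) = (if n = 0 then 1 else 0)" for n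
    proof -
      have "(\<Sum>k\<le>n. ?R F k * ?R G (n - k) * q powi (beta s s * int (k * (n - k))))
        = (\<Sum>k\<le>n. F $ k * G $ (n - k) * (z ^ n * q powi (beta s s * int (tri n))))"
      proof (intro sum.cong refl)
        fix k assume "k \<in> {..n}"
        then have n: "n = k + (n - k)" by simp
        have e: "q powi (beta s s * int (tri n)) = q powi (beta s s * int (tri k)) *
          q powi (beta s s * int (tri (n - k))) * q powi (beta s s * int (k * (n - k)))"
          by (subst n) (use q0 in \<open>simp only: tri_add of_nat_add distrib_left power_int_add simp_thms\<close>)
        have "z ^ n = z ^ k * z ^ (n - k)" by (subst n) (simp only: power_add)
        then show "?R F k * ?R G (n - k) * q powi (beta s s * int (k * (n - k)))
          = F $ k * G $ (n - k) * (z ^ n * q powi (beta s s * int (tri n)))"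
          unfolding e by (simp only: mult_ac)
      qed
      also have "\<dots> = (F * G) $ n * (z ^ n * q powi (beta s s * int (tri n)))"
        by (simp add: fps_mult_nth sum_distrib_right atLeast0AtMost)
      finally show ?thesis by (simp add: FG)
    qed
    moreover have "ray (\<lambda>n. if n = 0 then 1 else 0) s \<nu> = mon 1 (\<lambda>_. 0) \<nu>"
    proof (cases "\<nu> = smul 0 s")
      case True
      then show ?thesis by (simp only: ray_smul[where s = s and p = p, OF p]) (simp add: mon_def smul_def)
    next
      case False
      then have "\<nu> \<noteq> smul (\<nu> p) s \<or> \<nu> p \<noteq> 0" by metis
      moreover have "\<nu> \<noteq> (\<lambda>_. 0)" using False by (simp add: smul_def)
      ultimately show ?thesis by (simp only: ray_eq[where s = s and p = p, OF p]) (auto simp: mon_def smul_def)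
    qed
    ultimately show "star (ray (?R F) s) (ray (?R G) s) \<nu> = mon 1 (\<lambda>_. 0) \<nu>"
      by (simp add: star_ray_ray[where s = s and p = p, OF p fin])
  qed
  finally show ?thesis using Op_one[OF f] by simp
qed


section \<open>The bilinear form on unit vectors and segments\<close>

lemma cyc_pred_simps: "cyc_pred N 0 = N - 1" "0 < i \<Longrightarrow> i < N \<Longrightarrow> cyc_pred N i = i - 1"
proof -
  show "cyc_pred N 0 = N - 1" using N by (simp add: cyc_pred_def)
  show "cyc_pred N i = i - 1" if "0 < i" "i < N"
  proof -
    have "i + N - 1 = (i - 1) + N" using that by simp
    then show ?thesis using that by (simp only: cyc_pred_def mod_add_self2) simp
  qed
qed

lemma sum_cyc_pred: "(\<Sum>i<N. g (cyc_pred N i)) = (\<Sum>i<N. g i :: int)"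
proof -
  obtain M where M: "N = Suc M" using N by (cases N) auto
  have "(\<Sum>i<N. g (cyc_pred N i)) = g (cyc_pred N 0) + (\<Sum>i<M. g (cyc_pred N (Suc i)))"
    by (simp only: M sum.lessThan_Suc_shift)
  also have "(\<Sum>i<M. g (cyc_pred N (Suc i))) = (\<Sum>i<M. g i)"
    using cyc_pred_simps(2) by (intro sum.cong refl) (simp add: M)
  also have "g (cyc_pred N 0) = g M" using cyc_pred_simps(1) by (simp add: M)
  finally show ?thesis by (simp add: M)
qed

lemma beta_unit_left:
  assumes "j < N"
  shows "beta (unit_exp j) \<sigma> = int (\<sigma> j) - int (\<sigma> (cyc_pred N j))"
proof -
  have "beta (unit_exp j) \<sigma> = (\<Sum>i<N. if i = j then int (\<sigma> j) - int (\<sigma> (cyc_pred N j)) else 0)"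
    unfolding beta_def by (intro sum.cong) (auto simp: unit_exp_def)
  then show ?thesis using assms by simp
qed

lemma beta_unit_unit: "j < N \<Longrightarrow> beta (unit_exp j) (unit_exp j) = 1"
  using N by (cases "j = 0") (simp_all add: beta_unit_left cyc_pred_simps, simp_all add: unit_exp_def)

text \<open>A proper segment differs from its cyclic shift only at \<open>0\<close> and
  \<open>m\<close>, so all other summands vanish.\<close>

lemma beta_seg_right:
  assumes "0 < m" "m < N"
  shows "beta \<sigma> (seg m) = int (\<sigma> 0) - int (\<sigma> m)"
proof -
  have "int (\<sigma> i) * (int (seg m i) - int (seg m (cyc_pred N i)))
      = (if i = 0 then int (\<sigma> 0) else 0) - (if i = m then int (\<sigma> m) else 0)" if "i < N" for i
    using that assms by (cases "i = 0") (auto simp: cyc_pred_simps seg_def)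
  then have "beta \<sigma> (seg m) = (\<Sum>i<N. (if i = 0 then int (\<sigma> 0) else 0) - (if i = m then int (\<sigma> m) else 0))"
    unfolding beta_def by (intro sum.cong) auto
  then show ?thesis using assms by (simp add: sum_subtractf)
qed

lemma beta_seg_seg: "0 < m \<Longrightarrow> m < N \<Longrightarrow> beta (seg m) (seg m) = 1"
  by (simp add: beta_seg_right) (simp add: seg_def)

text \<open>With \<open>beta_seg_N_right\<close> this is the centrality of \<Lambda>: here the
  cyclic differences telescope, there the all-ones exponent is invariant under the shift.\<close>

lemma beta_seg_N_left: "beta (seg N) \<sigma> = 0"
  using sum_cyc_pred[of "\<lambda>i. int (\<sigma> i)"] by (simp add: beta_def seg_def sum_subtractf)

lemma beta_seg_N_right: "beta \<sigma> (seg N) = 0"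
  using N by (simp add: beta_def seg_def cyc_pred_def)

text \<open>
  The symbol of \<open>:\<phi>(x\<^sub>j \<dots> x\<^sub>0) \<phi>(x\<^sub>j\<^sub>+\<^sub>1) \<dots> \<phi>(x\<^sub>N\<^sub>-\<^sub>1):\<close>; the power of \<open>q\<close> is caused by
  \<open>x\<^sub>j \<dots> x\<^sub>0 = q\<^sup>-\<^sup>j :x\<^sub>j \<dots> x\<^sub>0:\<close> (operator products).
\<close>

definition partial_block :: "nat \<Rightarrow> mps" where
  "partial_block j = (\<lambda>\<mu>. if \<mu> \<in> exponents N \<and> (\<forall>i\<le>j. \<mu> i = \<mu> 0)
     then q powi (- int (j * \<mu> 0)) * (\<Prod>i\<in>{j..<N}. phi q $ \<mu> i) else 0)"

text \<open>The coefficients of \<open>\<phi>(q^(-k) z)\<close>. In the right block they form, along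
  \<open>seg (Suc k)\<close>, the symbol of \<open>e_q(-x_k ... x_0)\<close>.\<close>

definition psi :: "nat \<Rightarrow> nat \<Rightarrow> complex" where
  "psi k n = phi q $ n * q powi (- int (k * n))"

text \<open>\<open>partial_block j\<close> needs equal entries at \<open>0, ..., j\<close>, while
  the ray lowers only the entries below \<open>j\<close>. Just
  \<open>b = \<sigma> 0 - \<sigma> j\<close> can contribute, and the convolution collapses to one
  term.\<close>

lemma star_partial_block_ray:
  assumes j: "0 < j" "j < N" and fin: "finite {..\<sigma>}"
  shows "star (partial_block j) (ray (psi (j - 1)) (seg j)) \<sigma> =
    (if \<sigma> \<in> exponents N \<and> (\<forall>i<j. \<sigma> i = \<sigma> 0) \<and> \<sigma> j \<le> \<sigma> 0
     then psi (j - 1) (\<sigma> 0 - \<sigma> j) * (q powi (- int (j * \<sigma> j)) * (\<Prod>i\<in>{j..<N}. phi q $ \<sigma> i)) else 0)"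
    (is "_ = (if ?cond then ?val else 0)")
proof -
  define C where "C \<longleftrightarrow> ?cond"
  have partial_block_eq: "partial_block j (\<sigma> - smul b (seg j)) * q powi beta (\<sigma> - smul b (seg j)) (smul b (seg j))
      = (if C \<and> b = \<sigma> 0 - \<sigma> j then q powi (- int (j * \<sigma> j)) * (\<Prod>i\<in>{j..<N}. phi q $ \<sigma> i) else 0)"
    if b: "smul b (seg j) \<le> \<sigma>" for b
  proof -
    define \<tau> where "\<tau> = \<sigma> - smul b (seg j)"
    have b_le: "b \<le> \<sigma> i" if "i < j" for i
      using le_funD[OF b, of i] that by (simp add: smul_def seg_def)
    have lo: "\<tau> i = \<sigma> i - b" if "i < j" for i using that by (simp add: \<tau>_def smul_def seg_def)
    have hi: "\<tau> i = \<sigma> i" if "i \<ge> j" for i using that by (simp add: \<tau>_def smul_def seg_def)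
    have ex: "\<tau> \<in> exponents N \<longleftrightarrow> \<sigma> \<in> exponents N"
      using j by (auto simp: exponents_def hi)
    have all: "(\<forall>i\<le>j. \<tau> i = \<tau> 0) \<longleftrightarrow> (\<forall>i<j. \<sigma> i = \<sigma> 0) \<and> \<sigma> j \<le> \<sigma> 0 \<and> b = \<sigma> 0 - \<sigma> j" (is "?L = ?R")
    proof
      assume L: ?L
      have 1: "\<sigma> i = \<sigma> 0" if "i < j" for i
      proof -
        have "\<sigma> i - b = \<sigma> 0 - b" using L that j by (metis lo less_imp_le)
        then show ?thesis using b_le[OF that] b_le[of 0] j by simp
      qed
      have "\<sigma> j = \<sigma> 0 - b" using L j lo[of 0] hi[of j] by (metis order_refl)
      then have "\<sigma> j \<le> \<sigma> 0 \<and> b = \<sigma> 0 - \<sigma> j" using b_le[of 0] j by simp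
      then show ?R using 1 by blast
    next
      assume R: ?R
      show ?L
      proof (intro allI impI)
        fix i assume "i \<le> j"
        have b: "b = \<sigma> 0 - \<sigma> j" "\<sigma> j \<le> \<sigma> 0" using R by blast+
        show "\<tau> i = \<tau> 0"
        proof (cases "i = j")
          case True
          with b show ?thesis using lo[of 0] hi[of j] j by simp
        next
          case False
          then have "i < j" using \<open>i \<le> j\<close> by simp
          moreover from this have "\<sigma> i = \<sigma> 0" using R by blast
          ultimately show ?thesis using lo[of i] lo[of 0] j by simp
        qed
      qed
    qed
    show ?thesis
    proof (cases "C \<and> b = \<sigma> 0 - \<sigma> j")
      case True
      then have "b = \<sigma> 0 - \<sigma> j" "\<sigma> j \<le> \<sigma> 0" unfolding C_def by blast+
      then have tau0: "\<tau> 0 = \<sigma> j" using lo[of 0] j by simp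
      \<comment> \<open>By \<open>beta_seg_right\<close> this is
        \<open>b * (\<tau> 0 - \<tau> j)\<close>, and the two entries agree for this
        \<open>b\<close>.\<close>
      have beta: "beta \<tau> (smul b (seg j)) = 0"
        using hi[of j] tau0 j by (simp add: beta_smul_right beta_seg_right)
      have prod: "(\<Prod>i\<in>{j..<N}. phi q $ \<tau> i) = (\<Prod>i\<in>{j..<N}. phi q $ \<sigma> i)"
        by (intro prod.cong refl) (simp add: hi)
      have cond: "\<tau> \<in> exponents N \<and> (\<forall>i\<le>j. \<tau> i = \<tau> 0)" unfolding ex all using True unfolding C_def by blast
      have "partial_block j \<tau> * q powi beta \<tau> (smul b (seg j)) =
          q powi (- int (j * \<sigma> j)) * (\<Prod>i\<in>{j..<N}. phi q $ \<sigma> i)"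
        unfolding partial_block_def if_P[OF cond] unfolding tau0 beta prod by simp
      then show ?thesis unfolding \<tau>_def[symmetric] if_P[OF True] .
    next
      case False
      then have "\<not> (\<tau> \<in> exponents N \<and> (\<forall>i\<le>j. \<tau> i = \<tau> 0))" unfolding ex all C_def by blast
      then have "partial_block j \<tau> = 0" unfolding partial_block_def by (simp only: if_False)
      then show ?thesis using False unfolding \<tau>_def[symmetric] by (simp only: if_False mult_zero_left)
    qed
  qed
  have "star (partial_block j) (ray (psi (j - 1)) (seg j)) \<sigma> = (\<Sum>b\<le>\<sigma> 0. if smul b (seg j) \<le> \<sigma> then psi (j - 1) b *
      (partial_block j (\<sigma> - smul b (seg j)) * q powi beta (\<sigma> - smul b (seg j)) (smul b (seg j))) else 0)"
    by (rule star_ray_right[where p = 0 and s = "seg j", OF seg_0[OF j(1)] fin])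
  also have "\<dots> = (\<Sum>b\<le>\<sigma> 0. if b = \<sigma> 0 - \<sigma> j then (if C then ?val else 0) else 0)"
  proof (intro sum.cong refl)
    fix b
    show "(if smul b (seg j) \<le> \<sigma> then psi (j - 1) b *
        (partial_block j (\<sigma> - smul b (seg j)) * q powi beta (\<sigma> - smul b (seg j)) (smul b (seg j))) else 0)
      = (if b = \<sigma> 0 - \<sigma> j then (if C then ?val else 0) else 0)"
    proof (cases "smul b (seg j) \<le> \<sigma>")
      case True
      then show ?thesis by (simp only: partial_block_eq) simp
    next
      case False
      then obtain i where i: "\<sigma> i < smul b (seg j) i" by (auto simp: le_fun_def not_le)
      then have "i < j" by (auto simp: smul_def seg_def split: if_splits)
      \<comment> \<open>The surviving \<open>b\<close> never violates the guard: under
        \<open>C\<close> it is at most the common value \<open>\<sigma> 0\<close>.\<close>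
      have "\<not> (C \<and> b = \<sigma> 0 - \<sigma> j)"
      proof
        assume *: "C \<and> b = \<sigma> 0 - \<sigma> j"
        then have "\<sigma> i = \<sigma> 0" using \<open>i < j\<close> unfolding C_def by blast
        then show False using i * \<open>i < j\<close> by (simp add: smul_def seg_def)
      qed
      then show ?thesis using False by auto
    qed
  qed
  also have "\<dots> = (if C then ?val else 0)" by simp
  finally show ?thesis unfolding C_def .
qed

text \<open>The pentagon identity \<open>e\<^sub>q(Y) e\<^sub>q(X) = e\<^sub>q(X) e\<^sub>q(-XY) e\<^sub>q(Y)\<close> for \<open>YX = qXY\<close>, read from right to
  left, moves one factor \<open>x\<^sub>j\<close> out of the product \<open>x\<^sub>j \<dots> x\<^sub>0\<close>.\<close>

lemma star_ray_partial_block_ray: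
  assumes j: "0 < j" "j < N" and fin: "finite {..\<mu>}"
  shows "star (ray (($) (phi q)) (unit_exp j)) (star (partial_block j) (ray (psi (j - 1)) (seg j))) \<mu> = partial_block (j - 1) \<mu>"
proof -
  define M B where "M = \<mu> j" and "B = \<mu> 0"
  define P where "P = (\<Prod>i\<in>{Suc j..<N}. phi q $ \<mu> i)"
  define cond where "cond \<longleftrightarrow> \<mu> \<in> exponents N \<and> (\<forall>i<j. \<mu> i = B)"
  have le: "smul a (unit_exp j) \<le> \<mu>" if "a \<le> M" for a
    using that by (auto simp: smul_def unit_exp_def le_fun_def M_def)
  have inner: "star (partial_block j) (ray (psi (j - 1)) (seg j)) (\<mu> - smul a (unit_exp j))
       * q powi beta (smul a (unit_exp j)) (\<mu> - smul a (unit_exp j))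
     = (if cond \<and> M - a \<le> B then q powi (- int ((j - 1) * B)) * P *
          (phi q $ (M - a) * phi q $ (B - (M - a)) * q powi (- int ((M - a) + a * (B - (M - a))))) else 0)"
    if a: "a \<le> M" for a
  proof -
    define \<sigma> where "\<sigma> = \<mu> - smul a (unit_exp j)"
    have fin': "finite {..\<sigma>}"
      by (rule finite_subset[OF _ fin]) (auto simp: \<sigma>_def le_fun_def intro: order_trans[OF _ diff_le_self])
    have s: "\<sigma> j = M - a" "\<And>i. i \<noteq> j \<Longrightarrow> \<sigma> i = \<mu> i"
      by (simp_all add: \<sigma>_def smul_def unit_exp_def M_def)
    have ex: "\<sigma> \<in> exponents N \<longleftrightarrow> \<mu> \<in> exponents N"
      using j s(2) by (auto simp: exponents_def)
    have s0: "\<sigma> 0 = B" using s(2)[of 0] j by (simp add: B_def)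
    have c: "\<sigma> \<in> exponents N \<and> (\<forall>i<j. \<sigma> i = \<sigma> 0) \<and> \<sigma> j \<le> \<sigma> 0 \<longleftrightarrow> cond \<and> M - a \<le> B"
      unfolding ex s0 s(1) cond_def using s(2) by auto
    have prod: "(\<Prod>i\<in>{j..<N}. phi q $ \<sigma> i) = phi q $ (M - a) * P"
      unfolding P_def prod.atLeast_Suc_lessThan[OF j(2)] s(1)
      by (intro arg_cong2[where f = "(*)"] prod.cong refl) (simp add: s(2))
    show ?thesis
    proof (cases "cond \<and> M - a \<le> B")
      case False
      then show ?thesis
        unfolding \<sigma>_def[symmetric] star_partial_block_ray[OF j fin'] c by (simp only: if_False mult_zero_left)
    next
      case True
      have pred: "\<sigma> (cyc_pred N j) = B"
        using True s(2)[of "j - 1"] j by (auto simp: cyc_pred_simps cond_def)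
      have beta: "beta (smul a (unit_exp j)) \<sigma> = int a * (int (M - a) - int B)"
        by (simp only: beta_smul_left beta_unit_left[OF j(2)] pred s(1))
      \<comment> \<open>Here \<open>a\<close> counts the separate factors \<open>x_j\<close>,
        \<open>k\<close> the factors \<open>x_j ... x_0\<close> and \<open>b\<close> the factors
        \<open>x_(j-1) ... x_0\<close>, so that \<open>M = a + k\<close> and
        \<open>B = k + b\<close>.\<close>
      define k where "k = M - a"
      define b where "b = B - k"
      have B: "B = k + b" using True by (simp add: b_def k_def)
      obtain i where i: "j = Suc i" using j by (cases j) auto
      \<comment> \<open>The exponents regroup into a part free of \<open>a\<close> and the exponent
        occurring in \<open>phi_convolution\<close>.\<close>
      have "- int ((j - 1) * b) + (- int (j * k)) + int a * (int k - int B) = - int ((j - 1) * B) + (- int (k + a * b))"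
        by (simp add: B i algebra_simps)
      then have e: "q powi (- int ((j - 1) * b)) * q powi (- int (j * k)) * q powi (int a * (int k - int B))
        = q powi (- int ((j - 1) * B)) * q powi (- int (k + a * b))"
        using q0 by (simp only: power_int_add[symmetric] simp_thms)
      have "star (partial_block j) (ray (psi (j - 1)) (seg j)) \<sigma> * q powi beta (smul a (unit_exp j)) \<sigma>
        = phi q $ b * q powi (- int ((j - 1) * b)) * (q powi (- int (j * k)) * (phi q $ k * P)) * q powi (int a * (int k - int B))"
        unfolding star_partial_block_ray[OF j fin'] c using True by (simp only: prod beta s0 s(1) psi_def k_def b_def simp_thms if_True)
      also have "\<dots> = phi q $ b * phi q $ k * P * (q powi (- int ((j - 1) * b)) * q powi (- int (j * k)) * q powi (int a * (int k - int B)))"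
        by (simp only: mult_ac)
      also have "\<dots> = q powi (- int ((j - 1) * B)) * P * (phi q $ k * phi q $ b * q powi (- int (k + a * b)))"
        unfolding e by (simp only: mult_ac)
      finally show ?thesis unfolding \<sigma>_def[symmetric] using True by (simp only: k_def b_def simp_thms if_True)
    qed
  qed
  have "star (ray (($) (phi q)) (unit_exp j)) (star (partial_block j) (ray (psi (j - 1)) (seg j))) \<mu>
    = (\<Sum>a\<le>M. if smul a (unit_exp j) \<le> \<mu> then phi q $ a * (star (partial_block j) (ray (psi (j - 1)) (seg j)) (\<mu> - smul a (unit_exp j))
       * q powi beta (smul a (unit_exp j)) (\<mu> - smul a (unit_exp j))) else 0)"
    unfolding M_def by (rule star_ray_left[where p = j and s = "unit_exp j", OF unit_exp_self fin])
  also have "\<dots> = (\<Sum>a\<le>M. if cond \<and> M - a \<le> B then q powi (- int ((j - 1) * B)) * P *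
      (phi q $ a * phi q $ (M - a) * phi q $ (B - (M - a)) * q powi (- int ((M - a) + a * (B - (M - a))))) else 0)"
  proof (intro sum.cong refl)
    fix a assume "a \<in> {..M}"
    then have a: "a \<le> M" by simp
    show "(if smul a (unit_exp j) \<le> \<mu> then phi q $ a * (star (partial_block j) (ray (psi (j - 1)) (seg j)) (\<mu> - smul a (unit_exp j))
       * q powi beta (smul a (unit_exp j)) (\<mu> - smul a (unit_exp j))) else 0)
      = (if cond \<and> M - a \<le> B then q powi (- int ((j - 1) * B)) * P *
      (phi q $ a * phi q $ (M - a) * phi q $ (B - (M - a)) * q powi (- int ((M - a) + a * (B - (M - a))))) else 0)"
      unfolding if_P[OF le[OF a]] inner[OF a]
      by (cases "cond \<and> M - a \<le> B") (simp_all only: if_True if_False simp_thms mult_zero_right mult_zero_left mult_ac)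
  qed
  \<comment> \<open>Summing over \<open>k = M - a\<close> brings the sum into the form of
    \<open>phi_convolution\<close>.\<close>
  also have "\<dots> = (\<Sum>k\<le>M. if cond \<and> k \<le> B then q powi (- int ((j - 1) * B)) * P *
      (phi q $ (M - k) * phi q $ k * phi q $ (B - k) * q powi (- int (k + (M - k) * (B - k)))) else 0)"
    by (rule sum.reindex_bij_witness[of _ "\<lambda>k. M - k" "\<lambda>k. M - k"]) auto
  also have "\<dots> = (if cond then q powi (- int ((j - 1) * B)) * P * (\<Sum>k\<le>M. if k \<le> B then
      phi q $ (M - k) * phi q $ k * phi q $ (B - k) * q powi (- int (k + (M - k) * (B - k))) else 0) else 0)"
    unfolding sum_distrib_left by (cases cond) (auto intro!: sum.cong)
  also have "\<dots> = (if cond then q powi (- int ((j - 1) * B)) * P * (phi q $ M * phi q $ B) else 0)"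
    by (simp only: phi_convolution[OF q1 q0])
  also have "\<dots> = partial_block (j - 1) \<mu>"
  proof -
    have lt: "i \<le> j - 1 \<longleftrightarrow> i < j" for i using j by auto
    have cond: "\<mu> \<in> exponents N \<and> (\<forall>i\<le>j - 1. \<mu> i = \<mu> 0) \<longleftrightarrow> cond"
      unfolding cond_def B_def lt by (rule refl)
    show ?thesis
    proof (cases cond)
      case True
      then have "\<mu> (j - 1) = B" using j unfolding cond_def by simp
      moreover have "{j - 1..<N} = insert (j - 1) (insert j {Suc j..<N})" "j - 1 \<notin> insert j {Suc j..<N}"
        using j by auto
      then have "(\<Prod>i\<in>{j - 1..<N}. phi q $ \<mu> i) = phi q $ \<mu> (j - 1) * (phi q $ M * P)"
        using j by (simp add: P_def M_def del: One_nat_def)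
      ultimately show ?thesis using True unfolding partial_block_def cond unfolding B_def[symmetric]
        by (simp only: if_True mult_ac)
    next
      case False
      then show ?thesis unfolding partial_block_def cond by (simp only: if_False)
    qed
  qed
  finally show ?thesis .
qed

text \<open>For \<open>j = N - 1\<close> all \<open>N\<close> entries must agree, which leaves a
  series in \<Lambda> alone: the central factor from which the peeling starts.\<close>

lemma partial_block_last: "partial_block (N - 1) = ray (psi (N - 1)) (seg N)"
proof
  fix \<mu>
  have iff: "\<mu> = smul (\<mu> 0) (seg N) \<longleftrightarrow> \<mu> \<in> exponents N \<and> (\<forall>i\<le>N - 1. \<mu> i = \<mu> 0)"
  proof
    assume eq: "\<mu> = smul (\<mu> 0) (seg N)"
    have "\<mu> i = (if i < N then \<mu> 0 else 0)" for i
      by (subst eq) (simp add: smul_def seg_def)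
    note * = this
    have "\<mu> i = 0" if "i \<ge> N" for i using *[of i] that by simp
    moreover have "\<mu> i = \<mu> 0" if "i \<le> N - 1" for i
    proof -
      have "i < N" using that N by simp
      then show ?thesis using *[of i] by simp
    qed
    ultimately show "\<mu> \<in> exponents N \<and> (\<forall>i\<le>N - 1. \<mu> i = \<mu> 0)" unfolding exponents_def by blast
  next
    assume eq: "\<mu> \<in> exponents N \<and> (\<forall>i\<le>N - 1. \<mu> i = \<mu> 0)"
    show "\<mu> = smul (\<mu> 0) (seg N)"
    proof
      fix i show "\<mu> i = smul (\<mu> 0) (seg N) i"
      proof (cases "i < N")
        case True
        then have "i \<le> N - 1" by simp
        with eq have "\<mu> i = \<mu> 0" by blast
        then show ?thesis using True by (simp add: smul_def seg_def)
      next
        case False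
        with eq have "\<mu> i = 0" unfolding exponents_def not_less by blast
        then show ?thesis using False by (simp add: smul_def seg_def)
      qed
    qed
  qed
  have last: "{N - 1..<N} = {N - 1}" and N0: "0 < N" using N by auto
  show "partial_block (N - 1) \<mu> = ray (psi (N - 1)) (seg N) \<mu>"
    unfolding ray_eq[where p = 0 and s = "seg N", OF seg_0[OF N0]] partial_block_def psi_def
    unfolding iff last
  proof (cases "\<mu> \<in> exponents N \<and> (\<forall>i\<le>N - 1. \<mu> i = \<mu> 0)")
    case True
    then have last_eq: "\<mu> (N - 1) = \<mu> 0" by blast
    show "(if \<mu> \<in> exponents N \<and> (\<forall>i\<le>N - 1. \<mu> i = \<mu> 0)
        then q powi - int ((N - 1) * \<mu> 0) * (\<Prod>i\<in>{N - 1}. phi q $ \<mu> i) else 0)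
      = (if \<mu> \<in> exponents N \<and> (\<forall>i\<le>N - 1. \<mu> i = \<mu> 0)
        then phi q $ \<mu> 0 * q powi - int ((N - 1) * \<mu> 0) else 0)"
      unfolding if_P[OF True] by (simp add: last_eq[unfolded One_nat_def])
  next
    case False
    then show "(if \<mu> \<in> exponents N \<and> (\<forall>i\<le>N - 1. \<mu> i = \<mu> 0)
        then q powi - int ((N - 1) * \<mu> 0) * (\<Prod>i\<in>{N - 1}. phi q $ \<mu> i) else 0)
      = (if \<mu> \<in> exponents N \<and> (\<forall>i\<le>N - 1. \<mu> i = \<mu> 0)
        then phi q $ \<mu> 0 * q powi - int ((N - 1) * \<mu> 0) else 0)"
      by (simp only: if_False)
  qed
qed

lemma Op_partial_block_last_commute: "Op (partial_block (N - 1)) (Op c f) = Op c (Op (partial_block (N - 1)) f)"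
  unfolding Op_Op
proof (rule Op_cong)
  fix \<nu> :: exponent assume fin: "finite {..\<nu>}"
  have "seg N 0 = 1" using N by (simp add: seg_0)
  from star_ray_left[where p = 0 and s = "seg N", OF this fin] star_ray_right[where p = 0 and s = "seg N", OF this fin]
  show "star (partial_block (N - 1)) c \<nu> = star c (partial_block (N - 1)) \<nu>"
    by (simp only: partial_block_last beta_smul_left beta_smul_right beta_seg_N_left beta_seg_N_right)
qed

lemma op_prod_partial_block_last_commute:
  "Op (partial_block (N - 1)) (op_prod (map (\<lambda>x. Op (c x)) xs) f) = op_prod (map (\<lambda>x. Op (c x)) xs) (Op (partial_block (N - 1)) f)"
  by (induction xs) (simp_all add: op_prod_Cons op_prod_Nil Op_partial_block_last_commute del: One_nat_def)

lemma op_prod_tame: "f \<in> tame \<Longrightarrow> op_prod (map (\<lambda>x. Op (c x)) xs) f \<in> tame"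
  by (cases xs) (simp_all add: op_prod_Cons op_prod_Nil Op_tame)

lemma op_prod_cong:
  assumes "\<And>x g. x \<in> set xs \<Longrightarrow> g \<in> tame \<Longrightarrow> S x g = Op (c x) g" "f \<in> tame"
  shows "op_prod (map S xs) f = op_prod (map (\<lambda>x. Op (c x)) xs) f"
  using assms by (induction xs) (simp_all add: op_prod_Cons op_prod_Nil op_prod_tame)

text \<open>Cancellation runs from the middle outwards, hence the reversed list. Representing
  \<open>T x\<close> by \<open>Op\<close> keeps the intermediate series in
  \<open>tame\<close>.\<close>

lemma op_prod_inverse:
  assumes "\<And>x g. x \<in> set xs \<Longrightarrow> g \<in> tame \<Longrightarrow> S x (T x g) = g"
    and "\<And>x g. x \<in> set xs \<Longrightarrow> g \<in> tame \<Longrightarrow> T x g = Op (c x) g" and f: "f \<in> tame"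
  shows "op_prod (map S (rev xs)) (op_prod (map T xs) f) = f"
  using assms(1,2)
proof (induction xs)
  case (Cons x xs)
  have "op_prod (map T xs) f \<in> tame"
    using op_prod_cong[of xs T c f] op_prod_tame[OF f] Cons.prems(2) f by simp
  then show ?case using Cons by (simp add: op_prod_append op_prod_Cons op_prod_Nil)
qed (simp add: op_prod_Nil)

text \<open>Downward induction from \<open>N - 1\<close>. The factors gained in a step sit at the
  two outer ends, so the induction hypothesis is applied to the image of \<open>f\<close> under the
  new right factor.\<close>

lemma op_prod_eq_partial_block:
  assumes "j \<le> N - 1" "f \<in> tame"
  shows "op_prod (map (\<lambda>i. Op (ray (($) (phi q)) (unit_exp i))) [Suc j..<N]) (Op (partial_block (N - 1))
           (op_prod (map (\<lambda>k. Op (ray (psi k) (seg (Suc k)))) (rev [j..<N - 1])) f)) = Op (partial_block j) f"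
  using assms
proof (induction j arbitrary: f rule: inc_induct)
  case base
  then show ?case using N by (simp add: op_prod_Nil)
next
  case (step j)
  let ?g = "Op (ray (psi j) (seg (Suc j))) f"
  have u: "[Suc j..<N] = Suc j # [Suc (Suc j)..<N]" "[j..<N - 1] = j # [Suc j..<N - 1]"
    using step.hyps by (auto simp: upt_conv_Cons)
  have "Op (ray (($) (phi q)) (unit_exp (Suc j))) (Op (partial_block (Suc j)) ?g) = Op (partial_block j) f"
    unfolding Op_Op
    by (rule Op_cong, rule star_ray_partial_block_ray[of "Suc j", simplified]) (use step.hyps in simp_all)
  then show ?case
    unfolding u using step.IH[of ?g] by (simp add: op_prod_Cons op_prod_Nil op_prod_append Op_tame)
qed

text \<open>The series in \<Lambda> stands in front here but between the two lists in the peeling;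
  centrality moves it.\<close>

lemma block_identity:
  assumes "f \<in> tame"
  shows "Op (ray (psi (N - 1)) (seg N)) (op_prod (map (\<lambda>i. Op (ray (($) (phi q)) (unit_exp i))) [1..<N])
           (op_prod (map (\<lambda>k. Op (ray (psi k) (seg (Suc k)))) (rev [0..<N - 1])) f)) = Op (partial_block 0) f"
  unfolding partial_block_last[symmetric]
  by (subst op_prod_partial_block_last_commute) (use op_prod_eq_partial_block[of 0, OF _ assms] in simp)


section \<open>Generators and their ordered products as one-term symbols\<close>

lemma wt_unit: "i < N \<Longrightarrow> wt (unit_exp i) = a i"
  by (simp add: wt_def unit_exp_def if_distrib[of "power _"] cong: if_cong)

lemma wt_seg: "wt (seg N) = (\<Prod>i<N. a i)"
  by (simp add: wt_def seg_def)

lemma mps_scale_Op: "mps_scale c (Op k f) = Op (mps_scale c k) f"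
  by (simp add: mps_scale_def Op_def sum_distrib_left mult_ac)

lemma mps_scale_mon: "mps_scale c (mon z s) = mon (c * z) s"
  by (auto simp: mps_scale_def mon_def)

lemma Op_unit:
  assumes "i < N"
  shows "Op (mon z (unit_exp i)) f =
    mps_scale (z * a i) (mps_mult (mps_var i) (q_theta q (\<lambda>\<theta>. \<theta> i - \<theta> (cyc_pred N i)) f))"
proof
  fix \<mu>
  show "Op (mon z (unit_exp i)) f \<mu> =
    mps_scale (z * a i) (mps_mult (mps_var i) (q_theta q (\<lambda>\<theta>. \<theta> i - \<theta> (cyc_pred N i)) f)) \<mu>"
  proof (cases "finite {..\<mu>}")
    case True
    then show ?thesis using assms
      unfolding Op_def mps_scale_def mps_mult_def mps_var_eq_mon sum_mon[OF True]
      by (simp add: wt_unit beta_unit_left q_theta_def)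
  qed (simp add: Op_def mps_scale_def mps_mult_def)
qed

lemma Op_seg_N: "Op (mon z (seg N)) f = mps_mult (mon (z * (\<Prod>i<N. a i)) (seg N)) f"
proof
  fix \<mu>
  show "Op (mon z (seg N)) f \<mu> = mps_mult (mon (z * (\<Prod>i<N. a i)) (seg N)) f \<mu>"
  proof (cases "finite {..\<mu>}")
    case True
    then show ?thesis
      unfolding Op_def mps_mult_def sum_mon[OF True] by (simp add: beta_seg_N_left wt_seg)
  qed (simp add: Op_def mps_mult_def)
qed

lemma seg_Suc: "seg (Suc k) = (\<lambda>i. seg k i + unit_exp k i)"
  by (auto simp: seg_def unit_exp_def fun_eq_iff)

lemma seg_1: "seg (Suc 0) = unit_exp 0"
  by (auto simp: seg_def unit_exp_def fun_eq_iff)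

text \<open>The generator with index \<open>k + 1\<close>, put on the left, acts by
  \<open>q^(\<theta>_(k+1) - \<theta>_k)\<close> on a monomial with exponents 0 and 1 there; each
  step costs a factor \<open>1/q\<close>.\<close>

lemma op_prod_descending:
  assumes X: "\<And>i g. i < N \<Longrightarrow> X i g = Op (mon 1 (unit_exp i)) g" and "k < N - 1"
  shows "op_prod (map X (rev [0..<Suc k])) g = Op (mon (q powi (- int k)) (seg (Suc k))) g"
  using assms(2)
proof (induction k)
  case 0
  then show ?case using X[of 0] by (simp add: op_prod_Cons op_prod_Nil seg_1)
next
  case (Suc k)
  have b: "beta (unit_exp (Suc k)) (seg (Suc k)) = -1"
    using Suc.prems by (simp add: beta_unit_left cyc_pred_simps) (simp add: seg_def)
  have "op_prod (map X (rev [0..<Suc (Suc k)])) g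
      = X (Suc k) (op_prod (map X (rev [0..<Suc k])) g)"
    by (simp add: op_prod_Cons)
  also have "\<dots> = Op (mon 1 (unit_exp (Suc k))) (Op (mon (q powi (- int k)) (seg (Suc k))) g)"
    unfolding Suc.IH[OF Suc_lessD[OF Suc.prems]] using Suc.prems by (intro X) simp
  also have "\<dots> = Op (mon (q powi (- int (Suc k))) (seg (Suc (Suc k)))) g"
  proof -
    have "q powi (- int k) * q powi (- 1) = q powi (- int (Suc k))"
      using q0 by (subst power_int_add[symmetric]) (auto simp: algebra_simps)
    then show ?thesis
      unfolding Op_mon_mon b seg_Suc[of "Suc k"] by (simp only: mult_1_left add.commute)
  qed
  finally show ?case .
qed

lemma op_prod_ascending:
  assumes X: "\<And>i g. i < N \<Longrightarrow> X i g = Op (mon z (unit_exp i)) g" and "k < N - 1"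
  shows "op_prod (map X [0..<Suc k]) g = Op (mon (z ^ Suc k) (seg (Suc k))) g"
  using assms(2)
proof (induction k arbitrary: g)
  case 0
  then show ?case using X[of 0] by (simp add: op_prod_Cons op_prod_Nil seg_1)
next
  case (Suc k)
  \<comment> \<open>The index \<open>k + 1\<close> lies outside the segment and is not the
    predecessor of any index in it; \<open>Suc k < N - 1\<close> separates it from
    \<open>N - 1\<close>, the predecessor of \<open>0\<close>.\<close>
  have b: "beta (seg (Suc k)) (unit_exp (Suc k)) = 0"
    unfolding beta_def
  proof (rule sum.neutral, intro ballI)
    fix i assume "i \<in> {..<N}"
    then show "int (seg (Suc k) i) * (int (unit_exp (Suc k) i) - int (unit_exp (Suc k) (cyc_pred N i))) = 0"
      using Suc.prems by (cases "i = 0") (auto simp: seg_def unit_exp_def cyc_pred_simps)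
  qed
  have "op_prod (map X [0..<Suc (Suc k)]) g = op_prod (map X [0..<Suc k]) (X (Suc k) g)"
    by (subst upt_Suc) (simp add: op_prod_append op_prod_Cons op_prod_Nil del: upt_Suc)
  also have "\<dots> = Op (mon (z ^ Suc k) (seg (Suc k))) (Op (mon z (unit_exp (Suc k))) g)"
    using Suc.prems Suc.IH[OF Suc_lessD[OF Suc.prems]] X[of "Suc k"] by simp
  also have "\<dots> = Op (mon (z ^ Suc (Suc k)) (seg (Suc (Suc k)))) g"
    unfolding Op_mon_mon b seg_Suc[of "Suc k"] by (simp add: mult.commute)
  finally show ?case .
qed

lemma op_series_ray:
  assumes T: "\<And>g. g \<in> tame \<Longrightarrow> T g = Op (mon z s) g" and f: "f \<in> tame" and p: "s p = 1"
    and G: "\<And>n. F $ n * z ^ n * q powi (beta s s * int (tri n)) = G n"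
  shows "op_series F T f = Op (ray G s) f"
  using op_series_mon[where s = s and p = p, OF T f p] by (simp only: G)

end

section \<open>Symbols of the normal ordered products\<close>

lemma mps_mult_mon:
  assumes "finite {..\<lambda>i. s i + t i}"
  shows "mps_mult (mon z s) (mon w t) = mon (z * w) (\<lambda>i. s i + t i)"
proof
  fix \<mu>
  show "mps_mult (mon z s) (mon w t) \<mu> = mon (z * w) (\<lambda>i. s i + t i) \<mu>"
  proof (cases "finite {..\<mu>}")
    case True
    have "s \<le> \<mu> \<and> \<mu> - s = t \<longleftrightarrow> \<mu> = (\<lambda>i. s i + t i)"
      by (auto simp: le_fun_def fun_eq_iff) (metis le_add_diff_inverse)
    then show ?thesis unfolding mps_mult_def sum_mon[OF True] by (auto simp: mon_def)
  next
    case False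
    then have "\<mu> \<noteq> (\<lambda>i. s i + t i)" using assms by blast
    then show ?thesis using False by (simp add: mps_mult_def mon_def)
  qed
qed

lemma mps_one_eq_mon: "mps_one = mon 1 (\<lambda>_. 0)"
  by (simp add: mps_one_def mon_def)

lemma mps_subst_var: "mps_subst F (mps_scale c (mps_var i)) = ray (\<lambda>n. F $ n * c ^ n) (unit_exp i)"
proof
  fix \<mu>
  have var: "mps_scale c (mps_var i) = mon c (unit_exp i)"
    by (simp add: mps_var_eq_mon mps_scale_def mon_def fun_eq_iff)
  have pow: "(mps_mult (mps_scale c (mps_var i)) ^^ n) mps_one = mon (c ^ n) (smul n (unit_exp i))" for n
  proof (induction n)
    case 0
    then show ?case by (simp add: mps_one_eq_mon smul_def)
  next
    case (Suc n)
    have add: "(\<lambda>j. unit_exp i j + smul n (unit_exp i) j) = smul (Suc n) (unit_exp i)"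
      by (simp add: smul_def fun_eq_iff)
    have "smul (Suc n) (unit_exp i) \<in> exponents (Suc i)"
      by (auto simp: exponents_def smul_def unit_exp_def)
    then have "finite {..smul (Suc n) (unit_exp i)}" by (rule finite_atMost_exponent)
    then show ?case
      unfolding funpow.simps o_apply Suc unfolding var by (subst mps_mult_mon) (simp_all add: add)
  qed
  have "mps_subst F (mps_scale c (mps_var i)) \<mu> = (\<Sum>n\<in>{\<mu> i}. F $ n * mon (c ^ n) (smul n (unit_exp i)) \<mu>)"
    unfolding mps_subst_def op_series_def pow
    by (rule suminf_finite) (auto simp: mon_def smul_def)
  then show "mps_subst F (mps_scale c (mps_var i)) \<mu> = ray (\<lambda>n. F $ n * c ^ n) (unit_exp i) \<mu>"
    unfolding ray_eq[where s = "unit_exp i" and p = i, OF unit_exp_self] by (simp add: mon_def)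
qed

text \<open>The factors involve different variables: the remaining product is free of the variable
  \<open>x\<close>, which forces \<open>k = \<mu> x\<close> in the convolution.\<close>

lemma mps_prod_ray:
  assumes "distinct xs"
  shows "mps_prod (map (\<lambda>i. ray (G i) (unit_exp i)) xs) \<mu>
       = (if \<forall>i. i \<notin> set xs \<longrightarrow> \<mu> i = 0 then \<Prod>i\<in>set xs. G i (\<mu> i) else 0)"
  using assms
proof (induction xs arbitrary: \<mu>)
  case Nil
  then show ?case by (auto simp: mps_prod_def mps_one_def fun_eq_iff)
next
  case (Cons x xs)
  let ?P = "mps_prod (map (\<lambda>i. ray (G i) (unit_exp i)) xs)"
  have step: "mps_prod (map (\<lambda>i. ray (G i) (unit_exp i)) (x # xs)) = mps_mult (ray (G x) (unit_exp x)) ?P"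
    by (simp add: mps_prod_def)
  show ?case
  proof (cases "finite {..\<mu>}")
    case True
    have P: "?P (\<mu> - smul k (unit_exp x)) =
        (if k = \<mu> x \<and> (\<forall>i. i \<notin> set (x # xs) \<longrightarrow> \<mu> i = 0) then \<Prod>i\<in>set xs. G i (\<mu> i) else 0)"
      if "k \<le> \<mu> x" for k
    proof -
      have "(\<forall>i. i \<notin> set xs \<longrightarrow> (\<mu> - smul k (unit_exp x)) i = 0) \<longleftrightarrow>
          k = \<mu> x \<and> (\<forall>i. i \<notin> set (x # xs) \<longrightarrow> \<mu> i = 0)"
        using that Cons.prems by (auto simp: smul_def unit_exp_def)
      moreover have "(\<Prod>i\<in>set xs. G i ((\<mu> - smul k (unit_exp x)) i)) = (\<Prod>i\<in>set xs. G i (\<mu> i))"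
        using Cons.prems by (intro prod.cong refl) (auto simp: smul_def unit_exp_def)
      moreover have "distinct xs" using Cons.prems by simp
      ultimately show ?thesis by (simp only: Cons.IH)
    qed
    have "mps_mult (ray (G x) (unit_exp x)) ?P \<mu> = (\<Sum>k\<le>\<mu> x. if smul k (unit_exp x) \<le> \<mu>
        then G x k * ?P (\<mu> - smul k (unit_exp x)) else 0)"
      unfolding mps_mult_def by (rule sum_ray[where p = x and s = "unit_exp x", OF unit_exp_self True])
    also have "\<dots> = (\<Sum>k\<le>\<mu> x. if k = \<mu> x then (if \<forall>i. i \<notin> set (x # xs) \<longrightarrow> \<mu> i = 0
        then G x (\<mu> x) * (\<Prod>i\<in>set xs. G i (\<mu> i)) else 0) else 0)"
    proof (intro sum.cong refl)
      fix k assume "k \<in> {..\<mu> x}"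
      then have "k \<le> \<mu> x" "smul k (unit_exp x) \<le> \<mu>" by (auto simp: smul_def unit_exp_def le_fun_def)
      then show "(if smul k (unit_exp x) \<le> \<mu> then G x k * ?P (\<mu> - smul k (unit_exp x)) else 0)
        = (if k = \<mu> x then (if \<forall>i. i \<notin> set (x # xs) \<longrightarrow> \<mu> i = 0
            then G x (\<mu> x) * (\<Prod>i\<in>set xs. G i (\<mu> i)) else 0) else 0)"
        using P by auto
    qed
    also have "\<dots> = (if \<forall>i. i \<notin> set (x # xs) \<longrightarrow> \<mu> i = 0 then G x (\<mu> x) * (\<Prod>i\<in>set xs. G i (\<mu> i)) else 0)"
      by (rule trans[OF sum.delta]) simp_all
    also have "G x (\<mu> x) * (\<Prod>i\<in>set xs. G i (\<mu> i)) = (\<Prod>i\<in>set (x # xs). G i (\<mu> i))"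
      using Cons.prems by simp
    finally show ?thesis unfolding step .
  next
    case False
    have "\<not> (\<forall>i. i \<notin> set (x # xs) \<longrightarrow> \<mu> i = 0)"
    proof
      assume *: "\<forall>i. i \<notin> set (x # xs) \<longrightarrow> \<mu> i = 0"
      then have "finite {..\<mu>}" by (intro finite_atMost_support[of "set (x # xs)"]) auto
      then show False using False by blast
    qed
    then show ?thesis using False unfolding step mps_mult_def by (simp only: if_False sum.infinite simp_thms)
  qed
qed

lemma Lambda_eq_mon: "Lambda N = mon 1 (seg N)"
proof -
  have *: "mps_prod (map (\<lambda>i. mps_var i) xs) = mon 1 (\<lambda>i. if i \<in> set xs then 1 else 0)"
    if "distinct xs" for xs
    using that
  proof (induction xs)
    case Nil
    then show ?case by (simp add: mps_prod_def mps_one_eq_mon)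
  next
    case (Cons x xs)
    have add: "(\<lambda>i. unit_exp x i + (if i \<in> set xs then 1 else 0)) = (\<lambda>i. if i \<in> set (x # xs) then 1 else 0)"
      using Cons.prems by (auto simp: unit_exp_def fun_eq_iff)
    have "finite {..\<lambda>i. if i \<in> set (x # xs) then 1 else 0 :: nat}"
      by (rule finite_atMost_support[of "set (x # xs)"]) auto
    then have "mps_mult (mon 1 (unit_exp x)) (mon 1 (\<lambda>i. if i \<in> set xs then 1 else 0))
        = mon 1 (\<lambda>i. if i \<in> set (x # xs) then 1 else 0)"
      by (subst mps_mult_mon) (simp_all only: add mult_1_left)
    then show ?case using Cons by (simp add: mps_prod_def mps_var_eq_mon)
  qed
  show ?thesis using *[of "[0..<N]"] by (simp add: Lambda_def seg_def)
qed

context quantum_torus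
begin

lemma powi_sum: "finite A \<Longrightarrow> (\<Prod>i\<in>A. (q powi x i) ^ n i) = q powi (\<Sum>i\<in>A. int (n i) * x i)"
  by (induction A rule: finite_induct)
    (use q0 in \<open>simp_all add: power_int_add power_int_mult mult.commute[of "int _"]\<close>)

text \<open>The powers \<open>q^(\<nu>_i - \<nu>_(i-1))\<close>, raised to \<open>\<rho>_i\<close>
  and multiplied over \<open>i\<close>, give the factor \<open>q^(beta \<rho> \<nu>)\<close> built
  into \<open>Op\<close>. What remains is the product of coefficients of \<open>phi\<close>, which
  is \<open>partial_block 0\<close>.\<close>

lemma normal_ordered_eq_Op:
  "normal_ordered (\<lambda>\<theta>. mps_prod (map (\<lambda>i. mps_subst (phi q)
     (mps_scale (a i * q powi (\<theta> i - \<theta> (cyc_pred N i))) (mps_var i))) [0..<N])) f = Op (partial_block 0) f"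
proof
  fix \<mu>
  have prod: "mps_prod (map (\<lambda>i. mps_subst (phi q)
      (mps_scale (a i * q powi (int (\<nu> i) - int (\<nu> (cyc_pred N i)))) (mps_var i))) [0..<N]) \<rho>
    = partial_block 0 \<rho> * (wt \<rho> * q powi beta \<rho> \<nu>)" for \<nu> \<rho>
  proof -
    have ex: "(\<forall>i. i \<notin> set [0..<N] \<longrightarrow> \<rho> i = 0) \<longleftrightarrow> \<rho> \<in> exponents N"
      by (auto simp: exponents_def)
    have "(\<Prod>i<N. phi q $ \<rho> i * (a i * q powi (int (\<nu> i) - int (\<nu> (cyc_pred N i)))) ^ \<rho> i)
      = (\<Prod>i<N. phi q $ \<rho> i) * (wt \<rho> * q powi beta \<rho> \<nu>)"
      by (simp add: wt_def beta_def power_mult_distrib prod.distrib powi_sum)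
    then show ?thesis
      unfolding mps_subst_var mps_prod_ray[OF distinct_upt] ex
      by (simp add: partial_block_def atLeast0LessThan)
  qed
  show "normal_ordered (\<lambda>\<theta>. mps_prod (map (\<lambda>i. mps_subst (phi q)
     (mps_scale (a i * q powi (\<theta> i - \<theta> (cyc_pred N i))) (mps_var i))) [0..<N])) f \<mu> = Op (partial_block 0) f \<mu>"
    unfolding normal_ordered_def prod Op_def
    by (subst sum_atMost_reflect[of "\<lambda>\<nu> \<rho>. f \<nu> * (partial_block 0 \<rho> * (wt \<rho> * q powi beta \<rho> \<nu>))"]) (simp add: mult_ac)
qed

end

section \<open>The two blocks\<close>

lemma A_R_h_eq_A_R_n:
  assumes N: "N \<ge> 2" and q: "0 < norm q" "norm q < 1" and f: "f \<in> tame"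
  shows "A_R_h N q d db f = A_R_n N q d db f"
proof -
  define a where "a i = d i * db i" for i
  interpret quantum_torus N q a
    using N q one_minus_power_neq_0[OF q(2)] by unfold_locales auto
  have powi_pow: "(q powi (- int k)) ^ n = q powi (- int (k * n))" for k n
    by (simp only: power_int_minus power_int_of_nat power_inverse power_mult)
  have X: "x_hat N q d db i g = Op (mon 1 (unit_exp i)) g" if "i < N" for i g
    using that by (simp add: Op_unit x_hat_def a_def)
  \<comment> \<open>As \<open>beta\<close> is 1 here, normal ordering supplies
    \<open>q ^ tri n\<close>; with the sign \<open>(-1) ^ n\<close> the coefficients of
    \<open>e_q\<close> become those of \<open>phi\<close>.\<close>
  have hat: "op_series (e_q q) (mps_scale (-1) \<circ> x_hat N q d db i) g = Op (ray (($) (phi q)) (unit_exp i)) g"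
    if "i < N" "g \<in> tame" for i g
  proof (rule op_series_ray[where z = "-1" and p = i])
    show "e_q q $ n * (-1) ^ n * q powi (beta (unit_exp i) (unit_exp i) * int (tri n)) = phi q $ n" for n
      using that(1) by (simp add: beta_unit_unit phi_nth e_q_def)
  qed (use that in \<open>simp_all add: X mps_scale_Op mps_scale_mon\<close>)
  have hats: "op_series (e_q q) (mps_scale (-1) \<circ> op_prod (map (x_hat N q d db) (rev [0..<Suc k]))) g
      = Op (ray (psi k) (seg (Suc k))) g" if "k < N - 1" "g \<in> tame" for k g
  proof (rule op_series_ray[where z = "- (q powi (- int k))" and p = 0])
    show "e_q q $ n * (- (q powi (- int k))) ^ n * q powi (beta (seg (Suc k)) (seg (Suc k)) * int (tri n)) = psi k n" for n
      using that(1) unfolding power_minus[of "q powi (- int k)"] powi_pow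
      by (simp add: beta_seg_seg phi_nth e_q_def psi_def)
    fix h
    have "op_prod (map (x_hat N q d db) (rev [0..<Suc k])) h = Op (mon (q powi (- int k)) (seg (Suc k))) h"
      by (rule op_prod_descending) (use X that in auto)
    then show "(mps_scale (-1) \<circ> op_prod (map (x_hat N q d db) (rev [0..<Suc k]))) h
        = Op (mon (- (q powi (- int k))) (seg (Suc k))) h"
      by (simp only: o_apply mps_scale_Op mps_scale_mon) simp
  qed (use that in \<open>simp_all add: seg_0\<close>)
  \<comment> \<open>Here \<open>beta\<close> is 0, so no Gaussian power arises;
    \<open>D_const\<close> is absorbed by the weights, and \<open>q powi (1 - int N)\<close> is the
    shift in \<open>psi (N - 1)\<close>.\<close>
  have Lam: "op_series (phi q) (mps_mult (mps_scale (q powi (1 - int N) * D_const N d db) (Lambda N))) g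
      = Op (ray (psi (N - 1)) (seg N)) g" if "g \<in> tame" for g
  proof (rule op_series_ray[where z = "q powi (1 - int N)" and p = 0])
    have "1 - int N = - int (N - 1)" using N by simp
    then show "phi q $ n * (q powi (1 - int N)) ^ n * q powi (beta (seg N) (seg N) * int (tri n)) = psi (N - 1) n" for n
      by (simp only: powi_pow beta_seg_N_left psi_def) simp
    show "mps_mult (mps_scale (q powi (1 - int N) * D_const N d db) (Lambda N)) h
        = Op (mon (q powi (1 - int N)) (seg N)) h" for h
      by (simp add: Op_seg_N Lambda_eq_mon mps_scale_mon D_const_def a_def)
  qed (use that N in \<open>simp_all add: seg_0\<close>)
  let ?g = "op_prod (map (\<lambda>k. Op (ray (psi k) (seg (Suc k)))) (rev [0..<N - 1])) f"
  have 1: "op_prod (map (\<lambda>k. op_series (e_q q) (mps_scale (-1) \<circ>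
      op_prod (map (x_hat N q d db) (rev [0..<Suc k])))) (rev [0..<N - 1])) f = ?g"
    by (rule op_prod_cong[OF hats f]) auto
  have 2: "op_prod (map (\<lambda>i. op_series (e_q q) (mps_scale (-1) \<circ> x_hat N q d db i)) [1..<N]) ?g
      = op_prod (map (\<lambda>i. Op (ray (($) (phi q)) (unit_exp i))) [1..<N]) ?g"
    by (rule op_prod_cong[OF hat op_prod_tame[OF f]]) auto
  have "A_R_h N q d db f = Op (partial_block 0) f"
    unfolding A_R_h_def op_prod_append op_prod_Cons op_prod_Nil 1 2
    by (subst Lam) (rule op_prod_tame[OF op_prod_tame[OF f]], rule block_identity[OF f])
  also have "\<dots> = A_R_n N q d db f"
    unfolding A_R_n_def x_hat_symbol_def using normal_ordered_eq_Op by (simp add: a_def)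
  finally show ?thesis .
qed

text \<open>From \<open>(1/q; 1/q)_n = (-1)^n q^(-n(n+1)/2) (q; q)_n\<close>: the signs cancel, and
  of the Gaussian powers only \<open>q ^ n\<close> survives.\<close>

lemma phi_inverse_nth:
  assumes "norm q < 1" "q \<noteq> 0"
  shows "phi (inverse q) $ n = e_q q $ n * q ^ n"
proof -
  have "q_fact (inverse q) n * q ^ (tri n + n) = (-1) ^ n * q_fact q n"
  proof (induction n)
    case (Suc n)
    have "(1 - inverse q ^ Suc n) * q ^ Suc n = - (1 - q ^ Suc n)"
      using assms(2) by (simp add: power_inverse field_simps)
    then have "q_fact (inverse q) (Suc n) * q ^ (tri (Suc n) + Suc n)
        = (q_fact (inverse q) n * q ^ (tri n + n)) * - (1 - q ^ Suc n)"
      unfolding q_fact_Suc power_add[of q _ "Suc n"] tri_simps by (metis mult.assoc mult.commute)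
    then show ?case by (simp only: Suc) (simp add: q_fact_Suc algebra_simps)
  qed simp
  then have F: "q_fact (inverse q) n = (-1) ^ n * q_fact q n / q ^ (tri n + n)"
    using assms(2) by (simp add: field_simps)
  show ?thesis
    using assms(2) unfolding phi_nth[of "inverse q"] F e_q_def power_inverse
    by (simp add: power_add field_simps)
qed

text \<open>By \<open>block_identity\<close> at \<open>inverse q\<close>, the inverse block is the
  product of the inverted factors of \<open>A_L_h\<close> in reverse order; these cancel one by
  one.\<close>

lemma A_L_h_left_inverse:
  assumes N: "N \<ge> 2" and q: "0 < norm q" "norm q < 1" and f: "f \<in> tame"
  shows "A_L_h N q (A_L_n_inverse N q f) = f"
proof -
  have qnz: "q \<noteq> 0" using q by auto
  \<comment> \<open>With this weight, \<phi> for \<open>inverse q\<close> at \<open>x/q\<close> is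
    \<open>e_q(x)\<close>, as the symbol of the inverse block requires. The generators
    \<open>x_check\<close> get symbol coefficient \<open>q\<close>, which cancels the
    weight.\<close>
  interpret quantum_torus N "inverse q" "\<lambda>_. inverse q"
    using N qnz one_minus_power_neq_0[OF q(2)] by unfold_locales (auto simp: power_inverse)
  note phi_inv = phi_inverse_nth[OF q(2) qnz]
  have phi_sign: "phi q $ n * (-1) ^ n = e_q q $ n * q ^ tri n" for n
    by (simp add: phi_nth e_q_def)
  have phi_e: "phi q * e_q q = 1" "e_q q * phi q = 1"
    by (simp_all add: e_q_eq_inverse_phi[OF q(2)] inverse_mult_eq_1 inverse_mult_eq_1')
  have X: "x_check N q i g = Op (mon q (unit_exp i)) g" if "i < N" for i g
  proof -
    have "q_theta (inverse q) (\<lambda>\<theta>. \<theta> i - \<theta> (cyc_pred N i)) g = q_theta q (\<lambda>\<theta>. - \<theta> i + \<theta> (cyc_pred N i)) g"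
      by (simp add: q_theta_def power_int_inverse flip: power_int_minus)
    then show ?thesis
      using that qnz by (simp add: Op_unit x_check_def mps_scale_def)
  qed
  have check: "(mps_scale (-1) \<circ> x_check N q i) g = Op (mon (- q) (unit_exp i)) g" if "i < N" for i g
    using that by (simp add: X mps_scale_Op mps_scale_mon)
  have checks: "(mps_scale (-1) \<circ> op_prod (map (x_check N q) [0..<Suc k])) g
      = Op (mon (- (q ^ Suc k)) (seg (Suc k))) g" if "k < N - 1" for k g
  proof -
    have "op_prod (map (x_check N q) [0..<Suc k]) g = Op (mon (q ^ Suc k) (seg (Suc k))) g"
      by (rule op_prod_ascending) (use X that in auto)
    then show ?thesis by (simp only: o_apply mps_scale_Op mps_scale_mon) simp
  qed
  have Lam: "mps_mult (Lambda N) g = Op (mon (q ^ N) (seg N)) g" for g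
    using qnz by (simp add: Op_seg_N Lambda_eq_mon power_inverse)
  have seg: "seg (Suc k) 0 = 1" "seg N 0 = 1" for k
    using N by (simp_all add: seg_0)
  let ?T1 = "\<lambda>F k. op_series F (mps_scale (-1) \<circ> op_prod (map (x_check N q) [0..<Suc k]))"
  let ?T2 = "\<lambda>F i. op_series F (mps_scale (-1) \<circ> x_check N q i)"
  let ?T3 = "\<lambda>F. op_series F (mps_mult (Lambda N))"
  \<comment> \<open>Normal ordering now produces powers of \<open>inverse q\<close>, which remove
    \<open>q ^ tri n\<close> from the coefficients of \<open>phi\<close> and leave those of
    \<open>e_q\<close>.\<close>
  have T1: "?T1 (phi q) k g = Op (ray (psi k) (seg (Suc k))) g" if "k < N - 1" "g \<in> tame" for k g
  proof (rule op_series_ray[where p = 0, OF checks[OF that(1)] that(2)])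
    fix n
    have "phi q $ n * (- (q ^ Suc k)) ^ n = (phi q $ n * (-1) ^ n) * (q ^ n * q ^ (k * n))"
      unfolding power_minus[of "q ^ Suc k"] power_mult[symmetric] by (simp add: power_add)
    then show "phi q $ n * (- (q ^ Suc k)) ^ n * inverse q powi (beta (seg (Suc k)) (seg (Suc k)) * int (tri n)) = psi k n"
      using that(1) qnz unfolding phi_sign
      by (simp add: beta_seg_seg psi_def phi_inv power_int_inverse power_int_minus power_inverse del: of_nat_mult)
  qed (rule seg)
  have T2: "?T2 (phi q) i g = Op (ray (($) (phi (inverse q))) (unit_exp i)) g" if "i < N" "g \<in> tame" for i g
  proof (rule op_series_ray[where p = i, OF check[OF that(1)] that(2)])
    fix n
    have "phi q $ n * (- q) ^ n = (phi q $ n * (-1) ^ n) * q ^ n"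
      unfolding power_minus[of q] by simp
    then show "phi q $ n * (- q) ^ n * inverse q powi (beta (unit_exp i) (unit_exp i) * int (tri n)) = phi (inverse q) $ n"
      using that(1) qnz unfolding phi_sign by (simp add: beta_unit_unit phi_inv power_inverse)
  qed (rule unit_exp_self)
  \<comment> \<open>Of the power \<open>q^(N n)\<close>, one \<open>q ^ n\<close> turns
    \<open>e_q\<close> into \<open>phi\<close> at \<open>inverse q\<close>; the rest is the shift in
    \<open>psi (N - 1)\<close>.\<close>
  have T3: "?T3 (e_q q) g = Op (ray (psi (N - 1)) (seg N)) g" if "g \<in> tame" for g
  proof (rule op_series_ray[where p = 0, OF Lam that])
    fix n
    obtain M where M: "N = Suc M" using N by (cases N) auto
    show "e_q q $ n * (q ^ N) ^ n * inverse q powi (beta (seg N) (seg N) * int (tri n)) = psi (N - 1) n"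
      unfolding beta_seg_N_left psi_def phi_inv power_mult[symmetric]
      by (simp add: M power_add power_int_inverse power_int_minus power_inverse del: of_nat_mult)
  qed (rule seg)
  let ?g1 = "op_prod (map (?T1 (phi q)) (rev [0..<N - 1])) f"
  let ?g2 = "op_prod (map (?T2 (phi q)) [1..<N]) ?g1"
  have g1: "?g1 = op_prod (map (\<lambda>k. Op (ray (psi k) (seg (Suc k)))) (rev [0..<N - 1])) f"
    by (rule op_prod_cong[OF T1 f]) auto
  then have t1: "?g1 \<in> tame" by (simp only: op_prod_tame[OF f])
  have g2: "?g2 = op_prod (map (\<lambda>i. Op (ray (($) (phi (inverse q))) (unit_exp i))) [1..<N]) ?g1"
    by (rule op_prod_cong[OF T2 t1]) auto
  then have t2: "?g2 \<in> tame" by (simp only: op_prod_tame[OF t1])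
  have symbol: "mps_subst (inverse (phi q)) (x_check_symbol N q i \<theta>)
      = mps_subst (phi (inverse q)) (mps_scale (inverse q * inverse q powi (\<theta> i - \<theta> (cyc_pred N i))) (mps_var i))" for i \<theta>
  proof -
    have "inverse q powi (\<theta> i - \<theta> (cyc_pred N i)) = q powi (- \<theta> i + \<theta> (cyc_pred N i))"
      by (simp add: power_int_inverse flip: power_int_minus)
    moreover have "e_q q $ n * q ^ n * (inverse q * c) ^ n = e_q q $ n * c ^ n" for n c
      using qnz by (simp add: power_mult_distrib power_inverse)
    ultimately show ?thesis
      by (simp only: x_check_symbol_def mps_subst_var phi_inv flip: e_q_eq_inverse_phi[OF q(2)])
  qed
  have "A_L_n_inverse N q f = Op (partial_block 0) f"
    unfolding A_L_n_inverse_def symbol by (rule normal_ordered_eq_Op)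
  also have "\<dots> = ?T3 (e_q q) ?g2"
    unfolding T3[OF t2] unfolding g2 unfolding g1 by (rule block_identity[OF f, symmetric])
  finally have inv: "A_L_n_inverse N q f = ?T3 (e_q q) ?g2" .
  have 3: "?T3 (phi q) (?T3 (e_q q) ?g2) = ?g2"
    by (rule op_series_inverse[where p = 0, OF Lam t2 seg(2) phi_e(1)])
  have 2: "op_prod (map (?T2 (e_q q)) (rev [1..<N])) ?g2 = ?g1"
  proof (rule op_prod_inverse[OF _ T2 t1])
    fix i g assume "i \<in> set [1..<N]" "g \<in> tame"
    then show "?T2 (e_q q) i (?T2 (phi q) i g) = g"
      by (intro op_series_inverse[where p = i, OF check _ unit_exp_self phi_e(2)]) auto
  qed auto
  have 1: "op_prod (map (?T1 (e_q q)) (rev (rev [0..<N - 1]))) ?g1 = f"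
  proof (rule op_prod_inverse[OF _ T1 f])
    fix k g assume "k \<in> set (rev [0..<N - 1])" "g \<in> tame"
    then show "?T1 (e_q q) k (?T1 (phi q) k g) = g"
      by (intro op_series_inverse[where p = 0, OF checks _ seg(1) phi_e(2)]) auto
  qed auto
  show ?thesis
    unfolding A_L_h_def inv op_prod_append op_prod_Cons op_prod_Nil 3 2
    using 1 by (simp only: rev_rev_ident)
qed

theorem proposition2p9:
  fixes N :: nat and q :: complex and d db :: "nat \<Rightarrow> complex"
  assumes "N \<ge> 2"
    and "0 < norm q" and "norm q < 1"
    and "\<forall>i<N. d i \<noteq> 0 \<and> db i \<noteq> 0"
  shows "(\<forall>f\<in>mps_space N. A_R_h N q d db f = A_R_n N q d db f) \<and>
         (\<forall>f\<in>mps_space N. A_L_h N q f = A_L_n N q f)"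
proof (intro conjI ballI)
  fix f assume f: "f \<in> mps_space N"
  then show "A_R_h N q d db f = A_R_n N q d db f"
    using A_R_h_eq_A_R_n[OF assms(1-3)] mps_space_subset_tame by blast
  have bij: "bij_betw (A_L_n_inverse N q) (mps_space N) (mps_space N)"
    by (rule bij_betw_A_L_n_inverse)
  \<comment> \<open>Surjectivity provides this preimage of \<open>f\<close>, so evaluating the left
    inverse property at it settles the claim.\<close>
  then have g: "A_L_n N q f \<in> mps_space N" "A_L_n_inverse N q (A_L_n N q f) = f"
    using f unfolding A_L_n_def by (metis bij_betw_imp_surj_on inv_into_into, metis bij_betw_imp_surj_on f_inv_into_f)
  then have "A_L_h N q (A_L_n_inverse N q (A_L_n N q f)) = A_L_n N q f"
    using A_L_h_left_inverse[OF assms(1-3)] mps_space_subset_tame by blast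
  then show "A_L_h N q f = A_L_n N q f" by (simp only: g(2))
qed

end
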